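(* Let $\beta,\gamma$ be strictly positive modal formulas in the single variable $p$, both containing $p$, with $\underline{d}_p(\beta)\geq 1$ and $\underline{d}_p(\gamma)\geq 2$. Then the logics $\mathrm{K4}_\gamma$, $\mathrm{wK4}_\gamma$ and $\mathrm{GL}_{\Diamond\beta}$ have the finite model property.
   Context: Modal formulas are built from countably many propositional variables and $\bot$ using $\to$ and a unary modality $\Diamond$; other connectives are abbreviations. A (normal modal) logic is a set of formulas containing all classical tautologies, $\Diamond\bot\to\bot$ and $\Diamond(p\vee q)\to\Diamond p\vee\Diamond q$, and closed under modus ponens, substitution, and the rule $\varphi\to\psi\,/\,\Diamond\varphi\to\Diamond\psi$. $\mathrm K$ is the smallest logic, and $\Lambda+\varphi$ is the smallest logic containing $\Lambda$ and $\varphi$. A formula is strictly positive (in $p$) if it is built from the variable $p$ and the constant $\top$ using only $\wedge$ and $\Diamond$. For such formulas let $D_p(p)=\{0\}$, $D_p(\top)=\emptyset$, $D_p(\alpha_1\wedge\alpha_2)=D_p(\alpha_1)\cup D_p(\alpha_2)$, $D_p(\Diamond\alpha)=\{k+1\mid k\in D_p(\alpha)\}$, and $\underline d_p(\alpha):=\min(D_p(\alpha)\cup\{\infty\})$ (the least number of nested $\Diamond$'s above an occurrence of $p$). $\mathrm{K4}_\gamma:=\mathrm K+(\gamma\to\Diamond p)$; $\mathrm{wK4}_\gamma:=\mathrm K+(\gamma\to\Diamond p\vee p)$; $\mathrm{GL}_{\Diamond\beta}:=\mathrm K+\bigl(\Diamond p\to\Diamond(p\wedge\neg\beta)\bigr)$.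 A logic has the finite model property if it is the set of all formulas valid in some class of finite Kripke frames. *)

theory Defs
  imports Main "HOL-Library.Extended_Nat"
begin

datatype fm = Var nat | Bot | Imp fm fm | Dia fm

abbreviation Neg :: "fm \<Rightarrow> fm" where "Neg a \<equiv> Imp a Bot"
abbreviation Top :: fm where "Top \<equiv> Imp Bot Bot"
abbreviation Or :: "fm \<Rightarrow> fm \<Rightarrow> fm" where "Or a b \<equiv> Imp (Imp a Bot) b"
abbreviation And :: "fm \<Rightarrow> fm \<Rightarrow> fm" where "And a b \<equiv> Imp (Imp a (Imp b Bot)) Bot"

primrec subst :: "(nat \<Rightarrow> fm) \<Rightarrow> fm \<Rightarrow> fm" where
  "subst s (Var n) = s n"
| "subst s Bot = Bot"
| "subst s (Imp a b) = Imp (subst s a) (subst s b)"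
| "subst s (Dia a) = Dia (subst s a)"

primrec vars :: "fm \<Rightarrow> nat set" where
  "vars (Var n) = {n}"
| "vars Bot = {}"
| "vars (Imp a b) = vars a \<union> vars b"
| "vars (Dia a) = vars a"

(* Truth-functional evaluation: variables and formulas of the form Dia a are
   the propositional atoms, with truth values supplied by v. *)
primrec bool_eval :: "(fm \<Rightarrow> bool) \<Rightarrow> fm \<Rightarrow> bool" where
  "bool_eval v (Var n) = v (Var n)"
| "bool_eval v Bot = False"
| "bool_eval v (Imp a b) = (bool_eval v a \<longrightarrow> bool_eval v b)"
| "bool_eval v (Dia a) = v (Dia a)"

definition tautology :: "fm \<Rightarrow> bool" where
  "tautology a \<longleftrightarrow> (\<forall>v. bool_eval v a)"

definition normal_logic :: "fm set \<Rightarrow> bool" where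
  "normal_logic L \<longleftrightarrow>
     (\<forall>a. tautology a \<longrightarrow> a \<in> L) \<and>
     Imp (Dia Bot) Bot \<in> L \<and>
     Imp (Dia (Or (Var 0) (Var 1))) (Or (Dia (Var 0)) (Dia (Var 1))) \<in> L \<and>
     (\<forall>a b. Imp a b \<in> L \<longrightarrow> a \<in> L \<longrightarrow> b \<in> L) \<and>
     (\<forall>s a. a \<in> L \<longrightarrow> subst s a \<in> L) \<and>
     (\<forall>a b. Imp a b \<in> L \<longrightarrow> Imp (Dia a) (Dia b) \<in> L)"

definition logic_K :: "fm set" where
  "logic_K = \<Inter> {L. normal_logic L}"

definition add_axiom :: "fm set \<Rightarrow> fm \<Rightarrow> fm set" where
  "add_axiom L a = \<Inter> {M. normal_logic M \<and> L \<subseteq> M \<and> a \<in> M}"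

inductive strictly_positive :: "nat \<Rightarrow> fm \<Rightarrow> bool" for p :: nat where
  "strictly_positive p (Var p)"
| "strictly_positive p Top"
| "strictly_positive p a \<Longrightarrow> strictly_positive p b \<Longrightarrow> strictly_positive p (And a b)"
| "strictly_positive p a \<Longrightarrow> strictly_positive p (Dia a)"

(* Only the values on strictly positive formulas in p matter; such a formula
   decomposes uniquely, since Top and And a b have different shapes.
   All other formulas are assigned arbitrary values. *)
fun depths :: "nat \<Rightarrow> fm \<Rightarrow> nat set" where
  "depths p (Var q) = (if q = p then {0} else {})"
| "depths p Top = {}"
| "depths p (And a b) = depths p a \<union> depths p b"
| "depths p (Dia a) = {k + 1 | k. k \<in> depths p a}"
| "depths p _ = {}"

definition min_depth :: "nat \<Rightarrow> fm \<Rightarrow> enat" where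
  "min_depth p a = Min (enat ` depths p a \<union> {\<infinity>})"

definition K4 :: "nat \<Rightarrow> fm \<Rightarrow> fm set" where
  "K4 p g = add_axiom logic_K (Imp g (Dia (Var p)))"

definition wK4 :: "nat \<Rightarrow> fm \<Rightarrow> fm set" where
  "wK4 p g = add_axiom logic_K (Imp g (Or (Dia (Var p)) (Var p)))"

(* The argument b is the formula beta of GL indexed by Dia beta; no further Dia
   is put in front of it. In particular GL_Dia p (Dia (Var p)) is the usual
   provability logic GL. *)
definition GL_Dia :: "nat \<Rightarrow> fm \<Rightarrow> fm set" where
  "GL_Dia p b = add_axiom logic_K (Imp (Dia (Var p)) (Dia (And (Var p) (Neg b))))"

record 'w kframe =
  worlds :: "'w set"
  acc :: "('w \<times> 'w) set"

definition kripke_frame :: "'w kframe \<Rightarrow> bool" where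
  "kripke_frame F \<longleftrightarrow> worlds F \<noteq> {} \<and> acc F \<subseteq> worlds F \<times> worlds F"

primrec sat :: "'w kframe \<Rightarrow> (nat \<Rightarrow> 'w set) \<Rightarrow> 'w \<Rightarrow> fm \<Rightarrow> bool" where
  "sat F V w (Var n) = (w \<in> V n)"
| "sat F V w Bot = False"
| "sat F V w (Imp a b) = (sat F V w a \<longrightarrow> sat F V w b)"
| "sat F V w (Dia a) = (\<exists>u\<in>worlds F. (w, u) \<in> acc F \<and> sat F V u a)"

definition valid_in :: "'w kframe \<Rightarrow> fm \<Rightarrow> bool" where
  "valid_in F a \<longleftrightarrow> (\<forall>V. \<forall>w\<in>worlds F. sat F V w a)"

(* Every finite frame is isomorphic to one whose worlds are natural numbers, so
   classes of finite frames may be taken to be sets of frames over nat. *)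
definition finite_model_property :: "fm set \<Rightarrow> bool" where
  "finite_model_property L \<longleftrightarrow>
     (\<exists>C :: nat kframe set.
        (\<forall>F\<in>C. kripke_frame F \<and> finite (worlds F)) \<and>
        L = {a. \<forall>F\<in>C. valid_in F a})"

end

theory Submission imports Defs begin

text \<open>
  A finite subframe of the canonical frame of \<open>K4\<^sub>\<gamma>\<close> or \<open>wK4\<^sub>\<gamma>\<close> validates the axiom again: points that \<open>x\<close>
  does not see are separated from \<open>x\<close> by formulas, and the disjunction of finitely many of these is
  substituted for \<open>p\<close>. So it is enough to find finitely many canonical points, one of them refuting
  the given formula, that contain witnesses for all relevant diamonds. They are selected along paths:
  a visible earlier point is reused as a witness, and otherwise a new witness is taken in a maximal
  cluster. That no path is infinite rests on one consequence of the axiom: after a point reachable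
  from \<open>x\<close> there are no long chains of points that \<open>x\<close> does not see. A maximal such chain inside the
  path ends in a point \<open>w\<close> that sees nothing but what \<open>x\<close> sees, while \<open>x\<close> sees the successor of \<open>w\<close>; if
  \<open>x\<close> sees as few formulas as possible, then \<open>w\<close> sees the formula for which its successor was chosen.
  Taken along an ultrafilter towards later points, this keeps the path in one cluster; taken towards
  earlier points, it contradicts the choice of a new witness.

  For \<open>GL\<close> indexed by \<open>\<diamond>\<beta>\<close>, which contains \<open>\<diamond>\<beta> \<rightarrow> \<diamond>p\<close>, the witness for a formula \<open>c\<close> at \<open>x\<close> can be chosen so that no
  long chain after it runs through points that satisfy \<open>c\<close> or are not seen by \<open>x\<close>. The end of a maximal
  chain of this kind sees fewer formulas than \<open>x\<close>, so the paths are finite, and they form a finite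
  irreflexive frame.
\<close>

section \<open>Chains and demands along a sequence\<close>

text \<open>Zorn's lemma is applied to families whose finite intersections are all infinite. A
  maximal family contains every set or its complement, and since its members are infinite, it
  contains all cofinite sets.\<close>

lemma free_ultrafilter_nat:
  obtains F :: "nat filter"
  where "F \<noteq> bot" and "F \<le> sequentially"
    and "\<And>P. \<not> eventually P F \<longleftrightarrow> eventually (\<lambda>n. \<not> P n) F"
proof -
  define A where "A = {S :: nat set set. \<forall>T \<subseteq> S. finite T \<longrightarrow> infinite (\<Inter> T)}"
  have "\<exists>M\<in>A. \<forall>X\<in>A. M \<subseteq> X \<longrightarrow> X = M"
  proof (rule subset_Zorn_nonempty)
    have "{} \<in> A"
      by (simp add: A_def)
    then show "A \<noteq> {}"
      by blast
    show "\<Union>C \<in> A" if "C \<noteq> {}" "subset.chain A C" for C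
      unfolding A_def
    proof clarify
      fix T assume "T \<subseteq> \<Union>C" "finite T" "finite (\<Inter> T)"
      then obtain B where "B \<in> C" "T \<subseteq> B"
        using finite_subset_Union_chain[OF _ _ \<open>C \<noteq> {}\<close> \<open>subset.chain A C\<close>] by metis
      moreover have "B \<in> A"
        using that \<open>B \<in> C\<close> by (auto simp: subset.chain_def)
      ultimately show False
        using \<open>finite T\<close> \<open>finite (\<Inter> T)\<close> by (auto simp: A_def)
    qed
  qed
  then obtain M where "M \<in> A" and max: "\<And>X. X \<in> A \<Longrightarrow> M \<subseteq> X \<Longrightarrow> X = M"
    by blast
  have M: "infinite (\<Inter> T)" if "T \<subseteq> M" "finite T" for T
    using \<open>M \<in> A\<close> that by (auto simp: A_def)
  \<comment> \<open>A set that cannot be added to \<open>M\<close> meets some finite intersection of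
    members in a finite set only; the closure properties below combine such witnesses.\<close>
  have out: "\<exists>T. T \<subseteq> M \<and> finite T \<and> finite (\<Inter> T \<inter> X)" if "X \<notin> M" for X
  proof (rule ccontr)
    assume *: "\<not> ?thesis"
    have "insert X M \<in> A"
      unfolding A_def
    proof clarify
      fix T assume T: "T \<subseteq> insert X M" "finite T" "finite (\<Inter> T)"
      have "\<Inter> (T - {X}) \<inter> X \<subseteq> \<Inter> T"
        by auto
      then have "finite (\<Inter> (T - {X}) \<inter> X)"
        using T(3) by (rule finite_subset)
      moreover have "T - {X} \<subseteq> M" "finite (T - {X})"
        using T by auto
      ultimately show False
        using * by blast
    qed
    then show False
      using max that by blast
  qed
  have superset: "X \<in> M" if "T \<subseteq> M" "finite T" "\<Inter> T \<subseteq> X" for T X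
  proof (rule ccontr)
    assume "X \<notin> M"
    then obtain T' where T': "T' \<subseteq> M" "finite T'" "finite (\<Inter> T' \<inter> X)"
      using out by blast
    have "\<Inter> (T \<union> T') \<subseteq> \<Inter> T' \<inter> X"
      using that by auto
    then have "finite (\<Inter> (T \<union> T'))"
      using T'(3) by (rule finite_subset)
    moreover have "T \<union> T' \<subseteq> M" "finite (T \<union> T')"
      using that T' by auto
    ultimately show False
      using M by blast
  qed
  have compl: "- X \<in> M" if "X \<notin> M" for X
  proof (rule ccontr)
    assume "- X \<notin> M"
    then obtain T T' where T: "T \<subseteq> M" "finite T" "finite (\<Inter> T \<inter> X)"
      and T': "T' \<subseteq> M" "finite T'" "finite (\<Inter> T' \<inter> - X)"
      using out \<open>X \<notin> M\<close> by metis
    have "\<Inter> (T \<union> T') \<subseteq> (\<Inter> T \<inter> X) \<union> (\<Inter> T' \<inter> - X)"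
      by auto
    moreover have "finite ((\<Inter> T \<inter> X) \<union> (\<Inter> T' \<inter> - X))"
      using T(3) T'(3) by (rule finite_UnI)
    ultimately have "finite (\<Inter> (T \<union> T'))"
      by (rule finite_subset)
    moreover have "T \<union> T' \<subseteq> M" "finite (T \<union> T')"
      using T T' by auto
    ultimately show False
      using M by blast
  qed
  have inf: "infinite X" if "X \<in> M" for X
    using M[of "{X}"] that by auto
  define F where "F = Abs_filter (\<lambda>P. {n. P n} \<in> M)"
  have "is_filter (\<lambda>P. {n. P n} \<in> M)"
  proof
    show "{n. True} \<in> M"
      using superset[of "{}"] by auto
    show "{n. P n \<and> Q n} \<in> M" if "{n. P n} \<in> M" "{n. Q n} \<in> M" for P Q
      using superset[of "{{n. P n}, {n. Q n}}" "{n. P n \<and> Q n}"] that by auto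
    show "{n. Q n} \<in> M" if "\<forall>n. P n \<longrightarrow> Q n" "{n. P n} \<in> M" for P Q
      using superset[of "{{n. P n}}" "{n. Q n}"] that by auto
  qed
  then have ev: "eventually P F \<longleftrightarrow> {n. P n} \<in> M" for P
    by (simp add: F_def eventually_Abs_filter)
  have ultra: "\<not> eventually P F \<longleftrightarrow> eventually (\<lambda>n. \<not> P n) F" for P
  proof
    show "eventually (\<lambda>n. \<not> P n) F" if "\<not> eventually P F"
      using compl[of "{n. P n}"] that by (simp add: ev Collect_neg_eq)
    show "\<not> eventually P F" if "eventually (\<lambda>n. \<not> P n) F"
    proof
      assume "eventually P F"
      with that have "eventually (\<lambda>n. False) F"
        by eventually_elim auto
      then show False
        using inf by (auto simp: ev)
    qed
  qed
  have "F \<noteq> bot"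
    using inf[of "{}"] ev[of "\<lambda>_. False"] by (auto simp: trivial_limit_def)
  moreover have "F \<le> sequentially"
  proof (rule filter_leI)
    fix P :: "nat \<Rightarrow> bool" assume "eventually P sequentially"
    then obtain N where "\<And>n. n \<ge> N \<Longrightarrow> P n"
      by (auto simp: eventually_sequentially)
    then have "{n. \<not> P n} \<subseteq> {..<N}"
      by (auto simp: not_le[symmetric])
    then have "finite {n. \<not> P n}"
      using finite_subset by blast
    then show "eventually P F"
      using ultra[of P] inf by (auto simp: ev)
  qed
  ultimately show ?thesis
    using that ultra by blast
qed

text \<open>The \<open>n\<close> points of the chain come after \<open>y\<close>, which itself need not lie in \<open>P\<close>.\<close>

primrec chain :: "('w \<Rightarrow> 'w \<Rightarrow> bool) \<Rightarrow> 'w set \<Rightarrow> nat \<Rightarrow> 'w \<Rightarrow> bool" where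
  "chain R P 0 y = True"
| "chain R P (Suc n) y = (\<exists>z. R y z \<and> z \<in> P \<and> chain R P n z)"

lemma chain_weaken: "chain R P n y \<Longrightarrow> (\<And>z. z \<in> P \<Longrightarrow> z \<in> Q) \<Longrightarrow> chain R Q n y"
  by (induction n arbitrary: y) auto

lemma chain_pred: "chain R P (Suc n) y \<Longrightarrow> chain R P n y"
proof (induction n arbitrary: y)
  case (Suc n)
  from Suc.prems obtain z where "R y z" "z \<in> P" "chain R P (Suc n) z"
    by (metis chain.simps(2))
  with Suc.IH show ?case
    by (metis chain.simps(2))
qed simp

text \<open>Moving on within \<open>P\<close> must stop in fewer than \<open>n\<close> steps;
  \<open>w\<close> is where it stops.\<close>

lemma chain_end:
  assumes "y \<in> P" "\<not> chain R P n y"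
  obtains w where "w \<in> P" "R\<^sup>*\<^sup>* y w" "\<And>z. R w z \<Longrightarrow> z \<notin> P"
proof -
  have "\<exists>w. w \<in> P \<and> R\<^sup>*\<^sup>* y w \<and> (\<forall>z. R w z \<longrightarrow> z \<notin> P)"
    using assms
  proof (induction n arbitrary: y)
    case (Suc n)
    show ?case
    proof (cases "\<exists>z. R y z \<and> z \<in> P")
      case True
      then obtain z where z: "R y z" "z \<in> P"
        by blast
      then have "\<not> chain R P n z"
        using Suc.prems by auto
      with Suc.IH z show ?thesis
        by (blast intro: converse_rtranclp_into_rtranclp)
    next
      case False
      then show ?thesis
        using Suc.prems by blast
    qed
  qed simp
  then show ?thesis
    using that by blast
qed

lemma chain_map:
  assumes "chain Q P n y" "\<And>a b. Q a b \<Longrightarrow> R (f a) (f b)" "\<And>a. a \<in> P \<Longrightarrow> f a \<in> P'"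
  shows "chain R P' n (f y)"
  using assms(1)
proof (induction n arbitrary: y)
  case (Suc n)
  then obtain z where "Q y z" "z \<in> P" "chain Q P n z"
    by auto
  then have "R (f y) (f z) \<and> f z \<in> P' \<and> chain R P' n (f z)"
    using assms(2,3) Suc.IH by blast
  then show ?case
    by auto
qed simp

text \<open>
  Positions that see few formulas are the key: if \<open>s\<close> sees as few formulas as possible, then a
  maximal chain of positions invisible from \<open>s\<close> ends in a position \<open>w\<close> that sees no more than
  \<open>s\<close>, while \<open>s\<close> sees \<open>Suc w\<close>.
\<close>

lemma demand_visible:
  fixes E :: "nat \<Rightarrow> nat \<Rightarrow> bool" and \<phi> :: "nat \<Rightarrow> 'f" and G :: "nat \<Rightarrow> 'f set"
  assumes fin: "finite \<Gamma>" and \<phi>: "\<And>s. \<phi> s \<in> \<Gamma>" "\<And>s. \<phi> s \<in> G (Suc s)"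
    and bounded: "\<And>s t. \<not> chain (\<lambda>a b. E a b \<or> b = Suc a) {t. \<not> E s t} N t"
  shows "\<exists>s t. E s t \<and> \<phi> s \<in> G t"
proof -
  define seen where "seen s = {f\<in>\<Gamma>. \<exists>t. E s t \<and> f \<in> G t}" for s
  obtain s where min: "\<And>w. card (seen s) \<le> card (seen w)"
    using ex_has_least_nat[of "\<lambda>_. True" _ "\<lambda>s. card (seen s)"] by auto
  have fin_seen: "finite (seen w)" for w
    using fin by (simp add: seen_def)
  show ?thesis
  proof (cases "E s (Suc s)")
    case True
    then show ?thesis
      using \<phi> by blast
  next
    case False
    obtain w where w: "\<And>z. E w z \<or> z = Suc w \<Longrightarrow> z \<notin> {t. \<not> E s t}"
      using chain_end[OF _ bounded, of "Suc s" s] False by blast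
    then have "seen w \<subseteq> seen s"
      by (auto simp: seen_def)
    \<comment> \<open>Minimality of \<open>s\<close> gives equality. As \<open>s\<close> sees
      \<open>Suc w\<close>, where \<open>\<phi> w\<close> holds, \<open>w\<close> must itself see
      \<open>\<phi> w\<close> somewhere.\<close>
    then have "seen w = seen s"
      using min[of w] fin_seen card_seteq by blast
    moreover have "\<phi> w \<in> seen s"
      using w \<phi> by (auto simp: seen_def)
    ultimately have "\<phi> w \<in> seen w"
      by simp
    then show ?thesis
      by (auto simp: seen_def)
  qed
qed

text \<open>If each of finitely many values were avoided on a large set, all would be avoided at
  once. This assigns a single demand to each offset below.\<close>

lemma eventually_constant:
  assumes "F \<noteq> bot" "\<And>P. \<not> eventually P F \<longleftrightarrow> eventually (\<lambda>n. \<not> P n) F"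
    and "finite \<Gamma>" "\<And>n. f n \<in> \<Gamma>"
  obtains c where "c \<in> \<Gamma>" "\<forall>\<^sub>F n in F. f n = c"
proof (rule ccontr)
  assume "\<not> thesis"
  then have "\<forall>c\<in>\<Gamma>. \<forall>\<^sub>F n in F. f n \<noteq> c"
    using that assms(2) by blast
  then have "\<forall>\<^sub>F n in F. \<forall>c\<in>\<Gamma>. f n \<noteq> c"
    using assms(3) by (simp add: eventually_ball_finite)
  then have "\<forall>\<^sub>F n in F. False"
    by (rule eventually_mono) (use assms(4) in auto)
  then show False
    using assms(1) by simp
qed

text \<open>
  Below, \<open>E s t\<close> says that position \<open>s\<close> counted from a generic base point sees position \<open>t\<close> counted
  from a much later one, respectively from a much earlier one; the order of the two quantifiers
  decides which.
\<close>

lemma later_demand: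
  fixes x :: "nat \<Rightarrow> 'w"
  assumes inj: "inj x" and step: "\<And>i. R (x i) (x (Suc i))"
    and fin: "finite \<Gamma>" and \<psi>: "\<And>i. \<psi> i \<in> \<Gamma>" "\<And>i. \<psi> i \<in> T (x (Suc i))"
    and bounded: "\<And>i j. i \<le> j \<Longrightarrow> \<not> chain R {z. z \<noteq> x i \<and> \<not> R (x i) z} N (x j)"
  shows "\<exists>i. infinite {j. R (x i) (x j) \<and> \<psi> i \<in> T (x j)}"
proof -
  obtain F :: "nat filter" where F: "F \<noteq> bot" "F \<le> sequentially"
    and ultra: "\<And>P. \<not> eventually P F \<longleftrightarrow> eventually (\<lambda>n. \<not> P n) F"
    using free_ultrafilter_nat by blast
  have large: "\<forall>\<^sub>F n in F. n \<ge> k" for k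
    using F(2) filter_leD eventually_ge_at_top by blast
  have pick: "\<exists>n. P n" if "eventually P F" for P
    using that F(1) eventually_happens by blast
  define E where "E s t \<longleftrightarrow> (\<forall>\<^sub>F n in F. \<forall>\<^sub>F m in F. R (x (n + s)) (x (m + t)))" for s t
  define G where "G t = {f. \<forall>\<^sub>F m in F. f \<in> T (x (m + t))}" for t
  define U where "U i = {z. z \<noteq> x i \<and> \<not> R (x i) z}" for i
  have "\<exists>c. c \<in> \<Gamma> \<and> (\<forall>\<^sub>F n in F. \<psi> (n + s) = c)" for s
    using eventually_constant[OF F(1) ultra fin, of "\<lambda>n. \<psi> (n + s)"] \<psi>(1) by metis
  then obtain \<phi> where \<phi>: "\<And>s. \<phi> s \<in> \<Gamma>" "\<And>s. \<forall>\<^sub>F n in F. \<psi> (n + s) = \<phi> s"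
    by metis
  have \<phi>_Suc: "\<phi> s \<in> G (Suc s)" for s
    unfolding G_def mem_Collect_eq using \<phi>(2)[of s] by eventually_elim (metis \<psi>(2) add_Suc_right)
  have invisible: "\<forall>\<^sub>F n in F. \<forall>\<^sub>F m in F. x (m + t) \<in> U (n + s)" if "\<not> E s t" for s t
  proof -
    have "\<forall>\<^sub>F n in F. \<forall>\<^sub>F m in F. \<not> R (x (n + s)) (x (m + t))"
      using that by (simp add: E_def ultra)
    then show ?thesis
    proof eventually_elim
      case (elim n)
      with large[of "Suc (n + s)"] show ?case
        by eventually_elim (use inj in \<open>auto simp: U_def inj_eq\<close>)
    qed
  qed
  \<comment> \<open>A chain of offsets becomes a chain of actual points: a step along
    \<open>E\<close> changes to a base point \<open>m'\<close> chosen depending on \<open>m\<close>,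
    a step to \<open>Suc t\<close> keeps the base point.\<close>
  have realise: "\<forall>\<^sub>F n in F. \<forall>\<^sub>F m in F. chain R (U (n + s)) k (x (m + t))"
    if "chain (\<lambda>a b. E a b \<or> b = Suc a) {t. \<not> E s t} k t" for s t k
    using that
  proof (induction k arbitrary: t)
    case (Suc k)
    then obtain t' where t': "E t t' \<or> t' = Suc t" "\<not> E s t'"
      and "chain (\<lambda>a b. E a b \<or> b = Suc a) {t. \<not> E s t} k t'"
      by auto
    with Suc.IH have "\<forall>\<^sub>F n in F. \<forall>\<^sub>F m in F. chain R (U (n + s)) k (x (m + t'))"
      by blast
    with invisible[OF t'(2)] show ?case
    proof eventually_elim
      case (elim n)
      then have *: "\<forall>\<^sub>F m in F. x (m + t') \<in> U (n + s) \<and> chain R (U (n + s)) k (x (m + t'))"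
        by eventually_elim simp
      from t'(1) show ?case
      proof
        assume "E t t'"
        then show ?case
          unfolding E_def
        proof eventually_elim
          case (elim m)
          with * have "\<forall>\<^sub>F m' in F. R (x (m + t)) (x (m' + t')) \<and> x (m' + t') \<in> U (n + s) \<and>
              chain R (U (n + s)) k (x (m' + t'))"
            by eventually_elim simp
          then show ?case
            using pick by force
        qed
      next
        assume t': "t' = Suc t"
        from * show ?case
        proof eventually_elim
          case (elim m)
          then show ?case
            using step[of "m + t"] t' by auto
        qed
      qed
    qed
  qed simp
  have "\<not> chain (\<lambda>a b. E a b \<or> b = Suc a) {t. \<not> E s t} N t" for s t
  proof
    assume "chain (\<lambda>a b. E a b \<or> b = Suc a) {t. \<not> E s t} N t"
    then obtain n where "\<forall>\<^sub>F m in F. chain R (U (n + s)) N (x (m + t))"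
      using realise pick by blast
    \<comment> \<open>The hypothesis bounds only chains that start at or after
      \<open>x (n + s)\<close>.\<close>
    with large[of "n + s"] have "\<forall>\<^sub>F m in F. False"
      by eventually_elim (use bounded in \<open>auto simp: U_def\<close>)
    then show False
      using F(1) by simp
  qed
  then obtain s t where "E s t" "\<phi> s \<in> G t"
    using demand_visible[of \<Gamma> \<phi> G E N] fin \<phi>(1) \<phi>_Suc by blast
  from \<phi>(2)[of s] \<open>E s t\<close> have "\<forall>\<^sub>F n in F. \<psi> (n + s) = \<phi> s \<and> (\<forall>\<^sub>F m in F. R (x (n + s)) (x (m + t)))"
    unfolding E_def by eventually_elim simp
  then obtain n where n: "\<psi> (n + s) = \<phi> s" "\<forall>\<^sub>F m in F. R (x (n + s)) (x (m + t))"
    using pick by blast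
  have "\<exists>j\<ge>k. R (x (n + s)) (x j) \<and> \<psi> (n + s) \<in> T (x j)" for k
  proof -
    have "\<forall>\<^sub>F m in F. \<phi> s \<in> T (x (m + t))"
      using \<open>\<phi> s \<in> G t\<close> by (simp add: G_def)
    with n(2) large[of k] have "\<forall>\<^sub>F m in F. m + t \<ge> k \<and> R (x (n + s)) (x (m + t)) \<and> \<phi> s \<in> T (x (m + t))"
      by eventually_elim simp
    then obtain m where "m + t \<ge> k \<and> R (x (n + s)) (x (m + t)) \<and> \<phi> s \<in> T (x (m + t))"
      using pick by blast
    then show ?thesis
      using n(1) by (intro exI[of _ "m + t"]) simp
  qed
  then show ?thesis
    unfolding infinite_nat_iff_unbounded_le by blast
qed

text \<open>The observer \<open>x i\<close> now has the later base point, so the chains to be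
  bounded run through earlier points and may start before \<open>x i\<close>; the visible position
  found does not come after it.\<close>

lemma earlier_demand:
  fixes x :: "nat \<Rightarrow> 'w"
  assumes inj: "inj x" and step: "\<And>i. R (x i) (x (Suc i))"
    and fin: "finite \<Gamma>" and \<psi>: "\<And>i. \<psi> i \<in> \<Gamma>" "\<And>i. \<psi> i \<in> T (x (Suc i))"
    and bounded: "\<And>i j. \<not> chain R {z. z \<noteq> x i \<and> \<not> R (x i) z} N (x j)"
  shows "\<exists>i j. j \<le> i \<and> R (x i) (x j) \<and> \<psi> i \<in> T (x j)"
proof -
  obtain F :: "nat filter" where F: "F \<noteq> bot" "F \<le> sequentially"
    and ultra: "\<And>P. \<not> eventually P F \<longleftrightarrow> eventually (\<lambda>n. \<not> P n) F"
    using free_ultrafilter_nat by blast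
  have large: "\<forall>\<^sub>F n in F. n \<ge> k" for k
    using F(2) filter_leD eventually_ge_at_top by blast
  have pick: "\<exists>n. P n" if "eventually P F" for P
    using that F(1) eventually_happens by blast
  define E where "E s t \<longleftrightarrow> (\<forall>\<^sub>F m in F. \<forall>\<^sub>F n in F. R (x (n + s)) (x (m + t)))" for s t
  define G where "G t = {f. \<forall>\<^sub>F m in F. f \<in> T (x (m + t))}" for t
  define U where "U i = {z. z \<noteq> x i \<and> \<not> R (x i) z}" for i
  have "\<exists>c. c \<in> \<Gamma> \<and> (\<forall>\<^sub>F n in F. \<psi> (n + s) = c)" for s
    using eventually_constant[OF F(1) ultra fin, of "\<lambda>n. \<psi> (n + s)"] \<psi>(1) by metis
  then obtain \<phi> where \<phi>: "\<And>s. \<phi> s \<in> \<Gamma>" "\<And>s. \<forall>\<^sub>F n in F. \<psi> (n + s) = \<phi> s"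
    by metis
  have \<phi>_Suc: "\<phi> s \<in> G (Suc s)" for s
    unfolding G_def mem_Collect_eq using \<phi>(2)[of s] by eventually_elim (metis \<psi>(2) add_Suc_right)
  have invisible: "\<forall>\<^sub>F m in F. \<forall>\<^sub>F n in F. x (m + t) \<in> U (n + s)" if "\<not> E s t" for s t
  proof -
    have "\<forall>\<^sub>F m in F. \<forall>\<^sub>F n in F. \<not> R (x (n + s)) (x (m + t))"
      using that by (simp add: E_def ultra)
    then show ?thesis
    proof eventually_elim
      case (elim m)
      with large[of "Suc (m + t)"] show ?case
        by eventually_elim (use inj in \<open>auto simp: U_def inj_eq\<close>)
    qed
  qed
  have realise: "\<forall>\<^sub>F m in F. \<forall>\<^sub>F n in F. chain R (U (n + s)) k (x (m + t))"
    if "chain (\<lambda>a b. E a b \<or> b = Suc a) {t. \<not> E s t} k t" for s t k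
    using that
  proof (induction k arbitrary: t)
    case (Suc k)
    then obtain t' where t': "E t t' \<or> t' = Suc t" "\<not> E s t'"
      and "chain (\<lambda>a b. E a b \<or> b = Suc a) {t. \<not> E s t} k t'"
      by auto
    with Suc.IH have "\<forall>\<^sub>F m in F. \<forall>\<^sub>F n in F. chain R (U (n + s)) k (x (m + t'))"
      by blast
    with invisible[OF t'(2)]
    have *: "\<forall>\<^sub>F m in F. \<forall>\<^sub>F n in F. x (m + t') \<in> U (n + s) \<and> chain R (U (n + s)) k (x (m + t'))"
      by eventually_elim (simp add: eventually_conj)
    from t'(1) show ?case
    proof
      assume "E t t'"
      with * have "\<forall>\<^sub>F m' in F. (\<forall>\<^sub>F m in F. R (x (m + t)) (x (m' + t'))) \<and>
          (\<forall>\<^sub>F n in F. x (m' + t') \<in> U (n + s) \<and> chain R (U (n + s)) k (x (m' + t')))"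
        unfolding E_def by eventually_elim simp
      then obtain m' where m': "\<forall>\<^sub>F m in F. R (x (m + t)) (x (m' + t'))"
        "\<forall>\<^sub>F n in F. x (m' + t') \<in> U (n + s) \<and> chain R (U (n + s)) k (x (m' + t'))"
        using pick by blast
      from m'(1) show ?case
      proof eventually_elim
        case (elim m)
        from m'(2) show ?case
          by eventually_elim (use elim in auto)
      qed
    next
      assume t': "t' = Suc t"
      from * show ?case
      proof eventually_elim
        case (elim m)
        then show ?case
          by eventually_elim (use step[of "m + t"] t' in auto)
      qed
    qed
  qed simp
  have "\<not> chain (\<lambda>a b. E a b \<or> b = Suc a) {t. \<not> E s t} N t" for s t
  proof
    assume "chain (\<lambda>a b. E a b \<or> b = Suc a) {t. \<not> E s t} N t"
    then obtain m n where "chain R (U (n + s)) N (x (m + t))"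
      using realise pick by blast
    then show False
      using bounded by (auto simp: U_def)
  qed
  then obtain s t where "E s t" "\<phi> s \<in> G t"
    using demand_visible[of \<Gamma> \<phi> G E N] fin \<phi>(1) \<phi>_Suc by blast
  then have "\<forall>\<^sub>F m in F. \<forall>\<^sub>F n in F. R (x (n + s)) (x (m + t))" "\<forall>\<^sub>F m in F. \<phi> s \<in> T (x (m + t))"
    by (simp_all add: E_def G_def)
  then have "\<forall>\<^sub>F m in F. (\<forall>\<^sub>F n in F. R (x (n + s)) (x (m + t))) \<and> \<phi> s \<in> T (x (m + t))"
    by eventually_elim simp
  then obtain m where m: "\<forall>\<^sub>F n in F. R (x (n + s)) (x (m + t))" "\<phi> s \<in> T (x (m + t))"
    using pick by blast
  from m(1) large[of "m + t"] \<phi>(2)[of s]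
  have "\<forall>\<^sub>F n in F. m + t \<le> n + s \<and> R (x (n + s)) (x (m + t)) \<and> \<psi> (n + s) = \<phi> s"
    by eventually_elim simp
  then obtain n where "m + t \<le> n + s \<and> R (x (n + s)) (x (m + t)) \<and> \<psi> (n + s) = \<phi> s"
    using pick by blast
  then show ?thesis
    using m(2) by (intro exI[of _ "n + s"] exI[of _ "m + t"]) simp
qed

text \<open>Koenig's lemma: a point that reaches infinitely many points has a successor that does so
  too, and dependent choice would turn this into an infinite path.\<close>

lemma finite_reachable:
  assumes fin: "\<And>p. finite (succs p)"
    and no_path: "\<And>f. f 0 = p0 \<Longrightarrow> \<not> (\<forall>k. f (Suc k) \<in> succs (f k))"
  shows "finite {q. (\<lambda>p q. q \<in> succs p)\<^sup>*\<^sup>* p0 q}"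
proof (rule ccontr)
  let ?reach = "\<lambda>p. {q. (\<lambda>p q. q \<in> succs p)\<^sup>*\<^sup>* p q}"
  assume inf: "infinite (?reach p0)"
  have next_inf: "\<exists>q\<in>succs p. infinite (?reach q)" if "infinite (?reach p)" for p
  proof (rule ccontr)
    assume "\<not> ?thesis"
    then have "finite (insert p (\<Union>q\<in>succs p. ?reach q))"
      using fin by auto
    moreover have "?reach p \<subseteq> insert p (\<Union>q\<in>succs p. ?reach q)"
      by (auto elim: converse_rtranclpE)
    ultimately show False
      using that finite_subset by blast
  qed
  have "\<exists>f. \<forall>k. ((k = 0 \<longrightarrow> f k = p0) \<and> infinite (?reach (f k))) \<and> f (Suc k) \<in> succs (f k)"
    by (rule dependent_nat_choice) (use inf next_inf in \<open>simp_all, blast\<close>)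
  then obtain f where "f 0 = p0" "\<forall>k. f (Suc k) \<in> succs (f k)"
    by blast
  then show False
    using no_path by blast
qed

section \<open>The canonical model\<close>

text \<open>Strictly positive formulas contain no variable other than \<open>p\<close>, so one
  formula may be substituted for all variables at once.\<close>

definition subst_all :: "fm \<Rightarrow> fm \<Rightarrow> fm" where
  "subst_all c = subst (\<lambda>_. c)"

text \<open>Expresses \<open>chain\<close> for the points containing \<open>a\<close> inside the
  modal language, see \<open>mcs_chain\<close>.\<close>

primrec chain_fm :: "nat \<Rightarrow> fm \<Rightarrow> fm" where
  "chain_fm 0 a = Top"
| "chain_fm (Suc n) a = Dia (And a (chain_fm n a))"

locale modal_logic =
  fixes L :: "fm set"
  assumes normal: "normal_logic L"
begin

section \<open>Maximal consistent sets\<close>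

definition deductively_closed :: "fm set \<Rightarrow> bool" where
  "deductively_closed S \<longleftrightarrow> L \<subseteq> S \<and> (\<forall>a b. Imp a b \<in> S \<longrightarrow> a \<in> S \<longrightarrow> b \<in> S)"

definition mcs :: "fm set \<Rightarrow> bool" where
  "mcs w \<longleftrightarrow> deductively_closed w \<and> Bot \<notin> w \<and> (\<forall>a. a \<in> w \<or> Neg a \<in> w)"

definition R :: "fm set \<Rightarrow> fm set \<Rightarrow> bool" where
  "R x y \<longleftrightarrow> mcs x \<and> mcs y \<and> (\<forall>a\<in>y. Dia a \<in> x)"

lemma taut: "(\<And>v. bool_eval v a) \<Longrightarrow> a \<in> L"
  using normal by (simp add: normal_logic_def tautology_def)

lemma L_MP: "Imp a b \<in> L \<Longrightarrow> a \<in> L \<Longrightarrow> b \<in> L"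
  using normal by (auto simp: normal_logic_def)

lemma L_subst: "a \<in> L \<Longrightarrow> subst s a \<in> L"
  using normal by (auto simp: normal_logic_def)

lemma L_Dia: "Imp a b \<in> L \<Longrightarrow> Imp (Dia a) (Dia b) \<in> L"
  using normal by (auto simp: normal_logic_def)

lemma L_Dia_Or: "Imp (Dia (Or a b)) (Or (Dia a) (Dia b)) \<in> L"
proof -
  have "Imp (Dia (Or (Var 0) (Var 1))) (Or (Dia (Var 0)) (Dia (Var 1))) \<in> L"
    using normal by (auto simp: normal_logic_def)
  from L_subst[OF this, of "\<lambda>n. if n = 0 then a else b"] show ?thesis
    by simp
qed

lemma closedD: "deductively_closed S \<Longrightarrow> Imp a b \<in> S \<Longrightarrow> a \<in> S \<Longrightarrow> b \<in> S"
  by (auto simp: deductively_closed_def)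

lemma closed_taut: "deductively_closed S \<Longrightarrow> (\<And>v. bool_eval v a) \<Longrightarrow> a \<in> S"
  using taut by (auto simp: deductively_closed_def)

lemma closed_L: "deductively_closed L"
  using L_MP by (auto simp: deductively_closed_def)

text \<open>A maximal closed set omitting \<open>a\<close> contains \<open>Imp b a\<close> for every
  omitted \<open>b\<close>; omitting both \<open>b\<close> and \<open>Neg b\<close> would therefore
  yield \<open>a\<close>.\<close>

lemma lindenbaum:
  assumes S: "deductively_closed S" and a: "a \<notin> S"
  obtains w where "mcs w" "S \<subseteq> w" "a \<notin> w"
proof -
  define A where "A = {T. deductively_closed T \<and> S \<subseteq> T \<and> a \<notin> T}"
  have "\<exists>M\<in>A. \<forall>X\<in>A. M \<subseteq> X \<longrightarrow> X = M"
  proof (rule subset_Zorn_nonempty)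
    have "S \<in> A"
      using S a by (simp add: A_def)
    then show "A \<noteq> {}"
      by blast
    show "\<Union>C \<in> A" if C: "C \<noteq> {}" "subset.chain A C" for C
    proof -
      have CA: "\<And>T. T \<in> C \<Longrightarrow> T \<in> A" and lin: "\<And>T U. T \<in> C \<Longrightarrow> U \<in> C \<Longrightarrow> T \<subseteq> U \<or> U \<subseteq> T"
        using C(2) by (auto simp: subset_chain_def)
      have "c \<in> \<Union>C" if bc: "Imp b c \<in> \<Union>C" "b \<in> \<Union>C" for b c
      proof -
        obtain T U where "T \<in> C" "U \<in> C" "Imp b c \<in> T" "b \<in> U"
          using bc by blast
        then obtain T where "T \<in> C" "Imp b c \<in> T" "b \<in> T"
          using lin by blast
        then show ?thesis
          using CA closedD unfolding A_def by blast
      qed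
      moreover obtain T0 where "T0 \<in> C"
        using C(1) by blast
      then have "L \<subseteq> T0" "S \<subseteq> T0"
        using CA by (auto simp: A_def deductively_closed_def)
      then have "L \<subseteq> \<Union>C" "S \<subseteq> \<Union>C"
        using \<open>T0 \<in> C\<close> by blast+
      moreover have "a \<notin> \<Union>C"
        using CA by (auto simp: A_def)
      ultimately show ?thesis
        unfolding A_def deductively_closed_def by blast
    qed
  qed
  then obtain M where "M \<in> A" and max: "\<And>X. X \<in> A \<Longrightarrow> M \<subseteq> X \<Longrightarrow> X = M"
    by blast
  then have M: "deductively_closed M" "S \<subseteq> M" "a \<notin> M"
    by (auto simp: A_def)
  have ext: "Imp b a \<in> M" if "b \<notin> M" for b
  proof (rule ccontr)
    assume "Imp b a \<notin> M"
    \<comment> \<open>By the deduction theorem, \<open>X\<close> is the closure of \<open>M\<close>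
      with \<open>b\<close> added.\<close>
    define X where "X = {c. Imp b c \<in> M}"
    have sub: "M \<subseteq> X"
    proof
      fix c assume "c \<in> M"
      moreover have "Imp c (Imp b c) \<in> M"
        by (rule closed_taut[OF M(1)]) simp
      ultimately show "c \<in> X"
        using closedD[OF M(1)] by (auto simp: X_def)
    qed
    have "d \<in> X" if "Imp c d \<in> X" "c \<in> X" for c d
    proof -
      have "Imp (Imp b (Imp c d)) (Imp (Imp b c) (Imp b d)) \<in> M"
        by (rule closed_taut[OF M(1)]) simp
      then show ?thesis
        using that closedD[OF M(1)] by (auto simp: X_def)
    qed
    moreover have "L \<subseteq> M"
      using M(1) by (simp add: deductively_closed_def)
    ultimately have "deductively_closed X"
      using sub by (auto simp: deductively_closed_def)
    then have "X = M"
      using max[of X] sub M(2) \<open>Imp b a \<notin> M\<close> by (auto simp: A_def X_def)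
    moreover have "b \<in> X"
      unfolding X_def mem_Collect_eq by (rule closed_taut[OF M(1)]) simp
    ultimately show False
      using that by simp
  qed
  have "b \<in> M \<or> Neg b \<in> M" for b
  proof (rule ccontr)
    assume "\<not> ?thesis"
    then have "Imp b a \<in> M" "Imp (Neg b) a \<in> M"
      using ext by auto
    moreover have "Imp (Imp b a) (Imp (Imp (Neg b) a) a) \<in> M"
      by (rule closed_taut[OF M(1)]) auto
    ultimately show False
      using closedD[OF M(1)] M(3) by blast
  qed
  moreover have "Bot \<notin> M"
  proof
    assume "Bot \<in> M"
    moreover have "Imp Bot a \<in> M"
      by (rule closed_taut[OF M(1)]) simp
    ultimately show False
      using closedD[OF M(1)] M(3) by blast
  qed
  ultimately have "mcs M"
    using M(1) by (simp add: mcs_def)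
  then show ?thesis
    using that M by blast
qed

lemma mcs_closed: "mcs w \<Longrightarrow> deductively_closed w"
  by (simp add: mcs_def)

lemma mcs_L: "mcs w \<Longrightarrow> a \<in> L \<Longrightarrow> a \<in> w"
  by (auto simp: mcs_def deductively_closed_def)

lemma mcs_Bot [simp]: "mcs w \<Longrightarrow> Bot \<notin> w"
  by (simp add: mcs_def)

lemma mcs_Imp [simp]:
  assumes "mcs w"
  shows "Imp a b \<in> w \<longleftrightarrow> (a \<in> w \<longrightarrow> b \<in> w)"
proof
  show "a \<in> w \<longrightarrow> b \<in> w" if "Imp a b \<in> w"
    using closedD[OF mcs_closed[OF assms]] that by blast
  have "Imp (Neg a) (Imp a b) \<in> w" "Imp b (Imp a b) \<in> w"
    by (rule closed_taut[OF mcs_closed[OF assms]]; simp)+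
  moreover have "a \<in> w \<or> Neg a \<in> w"
    using assms by (simp add: mcs_def)
  ultimately show "Imp a b \<in> w" if "a \<in> w \<longrightarrow> b \<in> w"
    using closedD[OF mcs_closed[OF assms]] that by blast
qed

lemma mcs_complete: "(\<And>w. mcs w \<Longrightarrow> a \<in> w) \<Longrightarrow> a \<in> L"
  by (rule ccontr) (erule lindenbaum[OF closed_L], simp)

lemma mcs_Dia_mono:
  assumes "mcs w" "Dia a \<in> w" and "\<And>z. mcs z \<Longrightarrow> a \<in> z \<Longrightarrow> b \<in> z"
  shows "Dia b \<in> w"
proof -
  have "Imp a b \<in> L"
    by (rule mcs_complete) (use assms(3) in simp)
  then show ?thesis
    using mcs_L[OF assms(1) L_Dia] assms by simp
qed

lemma mcs_Dia_Or: "mcs w \<Longrightarrow> Dia (Or a b) \<in> w \<Longrightarrow> Dia a \<in> w \<or> Dia b \<in> w"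
  using mcs_L[OF _ L_Dia_Or[of a b]] by auto

lemma mcs_Dia_Bot: "mcs w \<Longrightarrow> Dia Bot \<notin> w"
  using mcs_L[of w "Imp (Dia Bot) Bot"] normal by (auto simp: normal_logic_def)

section \<open>The canonical relation\<close>

lemma RD: "R x y \<Longrightarrow> mcs x" "R x y \<Longrightarrow> mcs y" "R x y \<Longrightarrow> a \<in> y \<Longrightarrow> Dia a \<in> x"
  by (auto simp: R_def)

text \<open>\<open>S\<close> collects the \<open>c\<close> that \<open>x\<close> requires at all
  successors satisfying \<open>a\<close>. It is consistent because of \<open>Dia a\<close>, and any
  maximal consistent extension of it is a successor as desired.\<close>

lemma R_successor:
  assumes "mcs x" "Dia a \<in> x"
  obtains y where "R x y" "a \<in> y"
proof -
  define S where "S = {c. Dia (And a (Neg c)) \<notin> x}"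
  have "c \<in> S" if "c \<in> L" for c
  proof -
    have "Dia (And a (Neg c)) \<notin> x"
      using mcs_Dia_Bot[OF assms(1)] mcs_Dia_mono[OF assms(1), of "And a (Neg c)" Bot]
        mcs_L[OF _ that] by auto
    then show ?thesis
      by (simp add: S_def)
  qed
  moreover have "d \<in> S" if "Imp c d \<in> S" "c \<in> S" for c d
  proof (rule ccontr)
    assume "d \<notin> S"
    then have "Dia (Or (And a (Neg (Imp c d))) (And a (Neg c))) \<in> x"
      using mcs_Dia_mono[OF assms(1), of "And a (Neg d)"] by (auto simp: S_def)
    then show False
      using mcs_Dia_Or[OF assms(1)] that by (auto simp: S_def)
  qed
  ultimately have "deductively_closed S"
    by (auto simp: deductively_closed_def)
  moreover have "Dia (And a (Neg Bot)) \<in> x"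
    using assms(2) by (rule mcs_Dia_mono[OF assms(1)]) simp
  then have "Bot \<notin> S"
    by (simp add: S_def)
  ultimately obtain y where y: "mcs y" "S \<subseteq> y"
    by (rule lindenbaum)
  have "Dia (And a (Neg a)) \<notin> x"
    using mcs_Dia_Bot[OF assms(1)] mcs_Dia_mono[OF assms(1), of "And a (Neg a)" Bot] by auto
  then have "a \<in> y"
    using y(2) by (auto simp: S_def)
  have "Dia c \<in> x" if "c \<in> y" for c
  proof (rule ccontr)
    assume "Dia c \<notin> x"
    then have "Neg c \<in> S"
      using mcs_Dia_mono[OF assms(1), of "And a (Neg (Neg c))" c] by (auto simp: S_def)
    then show False
      using y that by auto
  qed
  then show ?thesis
    using that[of y] y(1) assms(1) \<open>a \<in> y\<close> by (simp add: R_def)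
qed

lemma mcs_Dia: "mcs x \<Longrightarrow> Dia a \<in> x \<longleftrightarrow> (\<exists>y. R x y \<and> a \<in> y)"
  using R_successor RD(3) by metis

lemma not_R: "mcs x \<Longrightarrow> mcs y \<Longrightarrow> \<not> R x y \<Longrightarrow> \<exists>a\<in>y. Dia a \<notin> x"
  by (auto simp: R_def)

lemma R_box:
  assumes "mcs x" "mcs y" "\<And>c. Neg (Dia (Neg c)) \<in> x \<Longrightarrow> c \<in> y"
  shows "R x y"
proof (rule ccontr)
  assume "\<not> R x y"
  then obtain a where a: "a \<in> y" "Dia a \<notin> x"
    using not_R assms by blast
  then have "Dia (Neg (Neg a)) \<notin> x"
    using mcs_Dia_mono[OF assms(1), of "Neg (Neg a)" a] by auto
  then have "Neg a \<in> y"
    using assms(1,3) by simp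
  then show False
    using a assms(2) by simp
qed

text \<open>The consequences of finite subsets of \<open>S\<close> form a consistent closed set, to
  which Lindenbaum's lemma applies.\<close>

lemma mcs_compact:
  assumes "\<And>S'. finite S' \<Longrightarrow> S' \<subseteq> S \<Longrightarrow> \<exists>w. mcs w \<and> S' \<subseteq> w"
  obtains w where "mcs w" "S \<subseteq> w"
proof -
  define T where "T = {c. \<exists>S'. finite S' \<and> S' \<subseteq> S \<and> (\<forall>w. mcs w \<longrightarrow> S' \<subseteq> w \<longrightarrow> c \<in> w)}"
  have "L \<subseteq> T"
    using mcs_L by (auto simp: T_def)
  moreover have "d \<in> T" if cd: "Imp c d \<in> T" "c \<in> T" for c d
  proof -
    obtain S1 S2 where "finite S1" "S1 \<subseteq> S" "\<And>w. mcs w \<Longrightarrow> S1 \<subseteq> w \<Longrightarrow> Imp c d \<in> w"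
      and "finite S2" "S2 \<subseteq> S" "\<And>w. mcs w \<Longrightarrow> S2 \<subseteq> w \<Longrightarrow> c \<in> w"
      using cd unfolding T_def by blast
    then show ?thesis
      unfolding T_def by (intro CollectI exI[of _ "S1 \<union> S2"]) auto
  qed
  ultimately have "deductively_closed T"
    by (auto simp: deductively_closed_def)
  moreover have "Bot \<notin> T"
    using assms mcs_Bot unfolding T_def by blast
  ultimately obtain w where "mcs w" "T \<subseteq> w"
    by (rule lindenbaum)
  moreover have "S \<subseteq> T"
  proof
    fix c assume "c \<in> S"
    then show "c \<in> T"
      unfolding T_def by (intro CollectI exI[of _ "{c}"]) auto
  qed
  ultimately show ?thesis
    using that by blast
qed

lemma mcs_chain: "mcs y \<Longrightarrow> chain_fm n a \<in> y \<longleftrightarrow> chain R {z. a \<in> z} n y"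
proof (induction n arbitrary: y)
  case (Suc n)
  then show ?case
    using RD(2) by (auto simp: mcs_Dia)
qed simp

lemma chain_mcs: "chain R P n y \<Longrightarrow> chain R {z \<in> P. mcs z} n y"
  by (induction n arbitrary: y) (auto dest: RD(2))

text \<open>Different points of a chain may contain different members of \<open>I\<close>; closure
  under \<open>Or\<close> merges them into one formula. \<open>c\<close> serves for the empty
  chain.\<close>

lemma chain_ideal:
  assumes "\<And>a b. a \<in> I \<Longrightarrow> b \<in> I \<Longrightarrow> Or a b \<in> I" and "c \<in> I"
    and "chain R {z. \<exists>a\<in>I. a \<in> z} n y"
  shows "\<exists>a\<in>I. chain R {z. a \<in> z} n y"
  using assms(3)
proof (induction n arbitrary: y)
  case 0
  then show ?case
    using assms(2) by auto
next
  case (Suc n)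
  then obtain z a where z: "R y z" "a \<in> I" "a \<in> z" "chain R {z. \<exists>a\<in>I. a \<in> z} n z"
    by auto
  then obtain b where b: "b \<in> I" "chain R {z. b \<in> z} n z"
    using Suc.IH by blast
  have "mcs z"
    using z(1) RD(2) by blast
  from chain_mcs[OF b(2)] have "chain R {z. Or a b \<in> z} n z"
    by (rule chain_weaken) auto
  moreover have "Or a b \<in> z"
    using z(3) \<open>mcs z\<close> by simp
  ultimately have "chain R {z. Or a b \<in> z} (Suc n) y"
    using z(1) by auto
  then show ?case
    using assms(1)[OF \<open>a \<in> I\<close> \<open>b \<in> I\<close>] by blast
qed

end

section \<open>Strictly positive formulas and maximal witnesses\<close>

lemma subst_all_simps [simp]:
  "subst_all c (Var n) = c" "subst_all c Bot = Bot"
  "subst_all c (Imp a b) = Imp (subst_all c a) (subst_all c b)" "subst_all c (Dia a) = Dia (subst_all c a)"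
  by (simp_all add: subst_all_def)

lemma finite_depths: "finite (depths p a)"
  by (induction p a rule: depths.induct) auto

lemma min_depth_le: "k \<in> depths p a \<Longrightarrow> min_depth p a \<le> enat k"
  unfolding min_depth_def by (rule Min_le) (auto simp: finite_depths)

section \<open>Strictly positive formulas along chains and under maps into the canonical
  model\<close>

context modal_logic
begin

text \<open>A single chain suffices: a diamond moves one point along it, and both conjuncts reuse
  the same chain. The size bounds the nesting of diamonds.\<close>

lemma sp_of_chain_at:
  assumes "strictly_positive p \<sigma>" "mcs w" "c \<in> w" "chain R {z. c \<in> z} n w" "size \<sigma> \<le> n"
  shows "subst_all c \<sigma> \<in> w"
  using assms
proof (induction arbitrary: w n rule: strictly_positive.induct)
  case (4 a)
  then obtain m where "n = Suc m" "size a \<le> m"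
    by (cases n) auto
  with 4 obtain z where z: "R w z" "c \<in> z" "chain R {z. c \<in> z} m z"
    by auto
  then have "subst_all c a \<in> z"
    using 4 \<open>size a \<le> m\<close> RD(2) by blast
  then show ?case
    using z(1) RD(3) by simp
qed auto

lemma sp_of_chain:
  assumes "strictly_positive p \<sigma>" "0 \<notin> depths p \<sigma>" "mcs w" "chain R {z. c \<in> z} n w" "size \<sigma> \<le> n"
  shows "subst_all c \<sigma> \<in> w"
  using assms
proof (induction arbitrary: w n rule: strictly_positive.induct)
  case (4 a)
  then obtain m where "n = Suc m" "size a \<le> m"
    by (cases n) auto
  with 4 obtain z where z: "R w z" "c \<in> z" "chain R {z. c \<in> z} m z"
    by auto
  then have "subst_all c a \<in> z"
    using 4 \<open>size a \<le> m\<close> RD(2) sp_of_chain_at by blast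
  then show ?case
    using z(1) RD(3) by simp
qed auto

text \<open>The chain may begin after a successor \<open>z\<close> that lacks \<open>c\<close>: at
  \<open>z\<close> the formula under the outer diamond has no occurrence of \<open>p\<close> at
  depth zero.\<close>

lemma sp_of_chain_above:
  assumes "strictly_positive p \<sigma>" "0 \<notin> depths p \<sigma>" "1 \<notin> depths p \<sigma>"
    and "R w z" "chain R {z. c \<in> z} n z" "size \<sigma> \<le> n"
  shows "subst_all c \<sigma> \<in> w"
  using assms
proof (induction arbitrary: n rule: strictly_positive.induct)
  case (4 a)
  then have "subst_all c a \<in> z"
    using RD(2) by (intro sp_of_chain[where p = p and n = n]) auto
  then show ?case
    using 4 RD(3) by simp
qed (auto dest: RD)

text \<open>The same merging by disjunctions, over finitely many worlds instead of along a
  chain.\<close>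

lemma ideal_common:
  assumes "\<And>a b. a \<in> I \<Longrightarrow> b \<in> I \<Longrightarrow> Or a b \<in> I" and "c \<in> I"
    and "finite P" "\<And>v. v \<in> P \<Longrightarrow> mcs (f v) \<and> (\<exists>a\<in>I. a \<in> f v)"
  shows "\<exists>a\<in>I. \<forall>v\<in>P. a \<in> f v"
  using assms(3,4)
proof (induction P)
  case empty
  then show ?case
    using assms(2) by blast
next
  case (insert v P)
  then obtain a b where ab: "a \<in> I" "\<forall>v\<in>P. a \<in> f v" "b \<in> I" "b \<in> f v"
    by blast
  have "Or a b \<in> f u" if "u \<in> insert v P" for u
    using that insert.prems[OF that] ab by auto
  then show ?case
    using assms(1) ab by blast
qed

text \<open>Strictly positive formulas are preserved by maps that preserve accessibility;
  \<open>c\<close> replaces the valuation of \<open>p\<close>, which it covers on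
  \<open>X\<close>.\<close>

lemma sp_sat_generated:
  assumes "strictly_positive p \<sigma>" "sat F V u \<sigma>" "u \<in> X"
    and "\<And>u. u \<in> X \<Longrightarrow> mcs (f u)" "\<And>u v. u \<in> X \<Longrightarrow> (u, v) \<in> acc F \<Longrightarrow> v \<in> X \<and> R (f u) (f v)"
    and "\<And>v. v \<in> X \<Longrightarrow> v \<in> V p \<Longrightarrow> c \<in> f v"
  shows "subst_all c \<sigma> \<in> f u"
  using assms(1-3)
proof (induction arbitrary: u rule: strictly_positive.induct)
  case (4 a)
  then obtain v where v: "(u, v) \<in> acc F" "sat F V v a"
    by auto
  then have "subst_all c a \<in> f v" "R (f u) (f v)"
    using 4 assms(5) by blast+
  then show ?case
    using RD(3) by simp
qed (use assms(4,6) in auto)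

text \<open>\<open>u\<close> may lie outside the set \<open>X\<close> on which \<open>c\<close>
  covers the valuation, since \<open>p\<close> does not occur at depth zero.\<close>

lemma sp_sat:
  assumes "strictly_positive p \<sigma>" "0 \<notin> depths p \<sigma>" "sat F V u \<sigma>" "mcs (f u)"
    and "\<And>v. (u, v) \<in> acc F \<Longrightarrow> v \<in> X \<and> R (f u) (f v)"
    and "\<And>u. u \<in> X \<Longrightarrow> mcs (f u)" "\<And>u v. u \<in> X \<Longrightarrow> (u, v) \<in> acc F \<Longrightarrow> v \<in> X \<and> R (f u) (f v)"
    and "\<And>v. v \<in> X \<Longrightarrow> v \<in> V p \<Longrightarrow> c \<in> f v"
  shows "subst_all c \<sigma> \<in> f u"
  using assms(1-3)
proof (induction rule: strictly_positive.induct)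
  case (4 a)
  then obtain v where v: "(u, v) \<in> acc F" "sat F V v a"
    by auto
  then have "subst_all c a \<in> f v" "R (f u) (f v)"
    using 4 assms(5) sp_sat_generated[OF _ _ _ assms(6-8)] by blast+
  then show ?case
    using RD(3) by simp
qed (use assms(4) in auto)

text \<open>For maximal consistent \<open>x\<close> and \<open>y\<close>,
  \<open>always x \<subseteq> y\<close> says that every formula of \<open>y\<close> holds somewhere
  reachable from \<open>x\<close>. This approximate reachability takes the place of the order of
  clusters.\<close>

definition always :: "fm set \<Rightarrow> fm set" where
  "always x = {a. \<forall>z. R\<^sup>*\<^sup>* x z \<longrightarrow> a \<in> z}"

lemma always_reach: "R\<^sup>*\<^sup>* x y \<Longrightarrow> always x \<subseteq> always y"
  unfolding always_def by (blast intro: rtranclp_trans)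

lemma always_subset: "always x \<subseteq> x"
  by (auto simp: always_def)

lemma mcs_reach: "R\<^sup>*\<^sup>* x y \<Longrightarrow> mcs x \<Longrightarrow> mcs y"
  by (induction rule: rtranclp_induct) (auto dest: RD)

text \<open>With \<open>a\<close>, \<open>always x\<close> also contains the formula saying that all
  successors satisfy \<open>a\<close>, so the inclusion passes from \<open>y\<close> to everything
  reachable from it.\<close>

lemma always_le:
  assumes "always x \<subseteq> y" "mcs x" "mcs y"
  shows "always x \<subseteq> always y"
proof -
  have "always x \<subseteq> z" if "R\<^sup>*\<^sup>* y z" for z
    using that
  proof (induction rule: rtranclp_induct)
    case base
    show ?case
      by (rule assms(1))
  next
    case (step z z')
    show ?case
    proof
      fix a assume a: "a \<in> always x"
      have "Neg (Dia (Neg a)) \<in> always x"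
        unfolding always_def mem_Collect_eq
      proof (intro allI impI)
        fix u assume u: "R\<^sup>*\<^sup>* x u"
        then have "mcs u"
          using mcs_reach assms(2) by blast
        have "a \<in> v" if "R u v" for v
          using a rtranclp.rtrancl_into_rtrancl[of R, OF u that] by (simp add: always_def)
        then show "Neg (Dia (Neg a)) \<in> u"
          using \<open>mcs u\<close> RD(2) by (auto simp: mcs_Dia)
      qed
      then have "Neg (Dia (Neg a)) \<in> z"
        using step by blast
      then show "a \<in> z'"
        using step(2) RD[OF step(2)] by (auto simp: mcs_Dia)
    qed
  qed
  then show ?thesis
    by (auto simp: always_def)
qed

text \<open>Zorn's lemma on the sets \<open>always y\<close> chooses a witness in a maximal cluster;
  compactness supplies the upper bound of a chain.\<close>

lemma maximal_successor:
  assumes x: "mcs x" and "Dia c \<in> x"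
  shows "\<exists>y. R x y \<and> c \<in> y \<and> (\<forall>z. R x z \<longrightarrow> c \<in> z \<longrightarrow> always y \<subseteq> z \<longrightarrow> always z \<subseteq> always y)"
proof -
  define A where "A = always ` {y. R x y \<and> c \<in> y}"
  have "\<exists>M\<in>A. \<forall>X\<in>A. M \<subseteq> X \<longrightarrow> X = M"
  proof (rule subset_Zorn)
    fix C assume C: "subset.chain A C"
    show "\<exists>U\<in>A. \<forall>X\<in>C. X \<subseteq> U"
    proof (cases "C = {}")
      case True
      then show ?thesis
        using assms R_successor unfolding A_def by (metis (mono_tags, lifting) empty_iff image_eqI mem_Collect_eq)
    next
      case False
      have CA: "\<And>X. X \<in> C \<Longrightarrow> X \<in> A"
        using C by (auto simp: subset_chain_def)
      \<comment> \<open>The boxed formulas of \<open>x\<close> make the limit a successor of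
        \<open>x\<close>, \<open>c\<close> makes it a witness, and the union puts it above the
        chain.\<close>
      let ?S = "\<Union>C \<union> ({d. Neg (Dia (Neg d)) \<in> x} \<union> {c})"
      obtain z where z: "mcs z" "?S \<subseteq> z"
      proof (rule mcs_compact)
        fix S' assume S': "finite S'" "S' \<subseteq> ?S"
        have "finite (S' \<inter> \<Union>C)" "S' \<inter> \<Union>C \<subseteq> \<Union>C"
          using S' by auto
        then obtain B where B: "B \<in> C" "S' \<inter> \<Union>C \<subseteq> B"
          using finite_subset_Union_chain[OF _ _ False C] by blast
        then obtain y where y: "B = always y" "R x y" "c \<in> y"
          using CA[OF B(1)] by (auto simp: A_def)
        have "d \<in> y" if "Neg (Dia (Neg d)) \<in> x" for d
          using that RD(3)[OF y(2), of "Neg d"] RD(1,2)[OF y(2)] by auto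
        then have "S' \<subseteq> y"
          using S'(2) B y(3) always_subset[of y] unfolding y(1) by blast
        then show "\<exists>w. mcs w \<and> S' \<subseteq> w"
          using y(2) RD(2) by blast
      qed
      have "R x z"
        using R_box[OF x z(1)] z(2) by blast
      then have "always z \<in> A"
        using z(2) by (auto simp: A_def)
      moreover have "X \<subseteq> always z" if X: "X \<in> C" for X
      proof -
        obtain y where y: "X = always y" "R x y"
          using CA[OF X] by (auto simp: A_def)
        moreover have "X \<subseteq> z"
          using z(2) X by blast
        ultimately show ?thesis
          using always_le[of y z] z(1) RD(2)[OF y(2)] by simp
      qed
      ultimately show ?thesis
        by blast
    qed
  qed
  then obtain y where y: "R x y" "c \<in> y"
    and max: "\<And>z. R x z \<Longrightarrow> c \<in> z \<Longrightarrow> always y \<subseteq> always z \<Longrightarrow> always z = always y"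
    by (auto simp: A_def)
  have "always z \<subseteq> always y" if "R x z" "c \<in> z" "always y \<subseteq> z" for z
    using max[OF that(1,2)] always_le[OF that(3)] y(1) that(1) RD(2) by blast
  then show ?thesis
    using y by blast
qed

end

section \<open>Selection for weakly transitive logics\<close>

locale weakly_transitive_logic = modal_logic +
  fixes p :: nat and \<gamma> :: fm
  assumes sp: "strictly_positive p \<gamma>"
    and deep: "0 \<notin> depths p \<gamma>" "1 \<notin> depths p \<gamma>"
    and ax: "Imp \<gamma> (Or (Dia (Var p)) (Var p)) \<in> L"
begin

text \<open>The point \<open>x\<close> counts as seen, in accordance with the disjunct
  \<open>Var p\<close> of the axiom.\<close>

definition unseen :: "fm set \<Rightarrow> fm set set" where
  "unseen x = {z. z \<noteq> x \<and> \<not> R x z}"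

abbreviation ideal :: "fm set \<Rightarrow> fm set" where
  "ideal x \<equiv> {a. a \<notin> x \<and> Dia a \<notin> x}"

lemma ideal_Or: "mcs x \<Longrightarrow> a \<in> ideal x \<Longrightarrow> b \<in> ideal x \<Longrightarrow> Or a b \<in> ideal x"
  using mcs_Dia_Or by auto

lemma ideal_Bot: "mcs x \<Longrightarrow> Bot \<in> ideal x"
  using mcs_Dia_Bot by auto

text \<open>For an unseen \<open>z\<close>, one formula of \<open>z\<close> refutes
  \<open>R x z\<close> and another separates \<open>z\<close> from \<open>x\<close>; their
  conjunction lies in the ideal.\<close>

lemma unseen_ideal:
  assumes "mcs x" "mcs z"
  shows "z \<in> unseen x \<longleftrightarrow> (\<exists>a\<in>ideal x. a \<in> z)"
proof
  assume z: "z \<in> unseen x"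
  obtain a where a: "a \<in> z" "Dia a \<notin> x"
    using z not_R[OF assms] by (auto simp: unseen_def)
  have "\<not> z \<subseteq> x"
  proof
    assume "z \<subseteq> x"
    have "x \<subseteq> z"
    proof
      fix b assume "b \<in> x"
      show "b \<in> z"
      proof (rule ccontr)
        assume "b \<notin> z"
        then have "Neg b \<in> z"
          using assms(2) by simp
        then show False
          using \<open>z \<subseteq> x\<close> \<open>b \<in> x\<close> assms(1) by auto
      qed
    qed
    then show False
      using z \<open>z \<subseteq> x\<close> by (auto simp: unseen_def)
  qed
  then obtain b where b: "b \<in> z" "b \<notin> x"
    by blast
  have "Dia (And a b) \<notin> x"
    using mcs_Dia_mono[OF assms(1), of "And a b" a] a by auto
  then have "And a b \<in> ideal x"
    using b assms(1) by simp
  then show "\<exists>a\<in>ideal x. a \<in> z"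
    using a b assms(2) by fastforce
next
  assume "\<exists>a\<in>ideal x. a \<in> z"
  then show "z \<in> unseen x"
    by (auto simp: unseen_def dest: RD(3))
qed

lemma chain_unseen_ideal:
  assumes "mcs x" "chain R (unseen x) n y"
  obtains a where "a \<in> ideal x" "chain R {z. a \<in> z} n y"
proof -
  from chain_mcs[OF assms(2)] have "chain R {z. \<exists>a\<in>ideal x. a \<in> z} n y"
    by (rule chain_weaken) (use unseen_ideal[OF assms(1)] in blast)
  then show ?thesis
    using chain_ideal[of "ideal x" Bot n y] ideal_Or ideal_Bot assms(1) that by blast
qed

lemma ax_instance:
  assumes "mcs w" "subst_all c \<gamma> \<in> w"
  shows "c \<in> w \<or> Dia c \<in> w"
proof -
  have "subst_all c (Imp \<gamma> (Or (Dia (Var p)) (Var p))) \<in> w"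
    unfolding subst_all_def using mcs_L[OF assms(1)] L_subst ax by blast
  then show ?thesis
    using assms by auto
qed

text \<open>\<open>Suc\<close> ensures that a chain of this length has a first point, which is a
  successor of its start.\<close>

definition bound :: nat where
  "bound = Suc (size \<gamma>)"

text \<open>A formula \<open>a\<close> of the ideal along such a chain would make
  \<open>\<gamma>\<close> with \<open>a\<close> for \<open>p\<close> true at \<open>x\<close>,
  because \<open>p\<close> occurs only at depth two and more; the axiom then puts \<open>a\<close>
  at \<open>x\<close> or at a successor.\<close>

lemma no_unseen_chain_after:
  assumes "R x y"
  shows "\<not> chain R (unseen x) bound y"
proof
  have "mcs x"
    using assms RD(1) by blast
  assume "chain R (unseen x) bound y"
  then obtain a where a: "a \<in> ideal x" "chain R {z. a \<in> z} bound y"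
    using chain_unseen_ideal[OF \<open>mcs x\<close>] by blast
  then have "subst_all a \<gamma> \<in> x"
    using sp_of_chain_above[OF sp deep assms a(2)] by (simp add: bound_def)
  then show False
    using ax_instance[OF \<open>mcs x\<close>] a(1) by blast
qed

text \<open>Induction along the path from \<open>x\<close>: an unseen next point would prolong the
  chain backwards to its predecessor, and a seen one is \<open>x\<close> or a successor of
  \<open>x\<close>.\<close>

lemma no_unseen_chain_reach:
  assumes "R\<^sup>*\<^sup>* x y"
  shows "\<not> chain R (unseen x) bound y"
  using assms
proof (induction rule: rtranclp_induct)
  case base
  show ?case
    by (auto simp: bound_def unseen_def)
next
  case (step y z)
  show ?case
  proof
    assume *: "chain R (unseen x) bound z"
    show False
    proof (cases "z \<in> unseen x")
      case True
      then have "chain R (unseen x) (Suc bound) y"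
        using step(2) * by auto
      then have "chain R (unseen x) bound y"
        by (rule chain_pred)
      then show False
        using step.IH by simp
    next
      case False
      then consider "z = x" | "R x z"
        by (auto simp: unseen_def)
      then show False
      proof cases
        case 1
        with * show False
          by (auto simp: bound_def unseen_def)
      next
        case 2
        with * show False
          using no_unseen_chain_after by blast
      qed
    qed
  qed
qed

text \<open>Such a chain is recorded by one formula \<open>chain_fm bound a\<close>, so one would
  already occur after a point reachable from \<open>x\<close>.\<close>

lemma no_unseen_chain:
  assumes "mcs x" "mcs y" "always x \<subseteq> y"
  shows "\<not> chain R (unseen x) bound y"
proof
  assume "chain R (unseen x) bound y"
  then obtain a where a: "a \<in> ideal x" "chain R {z. a \<in> z} bound y"
    using chain_unseen_ideal[OF assms(1)] by blast
  then have "Neg (chain_fm bound a) \<notin> always x"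
    using assms(2,3) mcs_chain[OF assms(2)] by auto
  then obtain z where z: "R\<^sup>*\<^sup>* x z" "chain R {z. a \<in> z} bound z"
    using mcs_reach[OF _ assms(1)] mcs_chain by (auto simp: always_def)
  from chain_mcs[OF z(2)] have "chain R (unseen x) bound z"
    by (rule chain_weaken) (use unseen_ideal[OF assms(1)] a(1) in blast)
  then show False
    using no_unseen_chain_reach z(1) by blast
qed

text \<open>\<open>later_demand\<close> yields a demand met by infinitely many later points.
  Maximality then makes all later \<open>always\<close> sets equal, so
  \<open>no_unseen_chain\<close> applies to any two of these points in either order, and
  \<open>earlier_demand\<close> contradicts \<open>fresh\<close>.\<close>

lemma no_infinite_selection:
  assumes step: "\<And>i. R (x i) (x (Suc i))"
    and fin: "finite \<Gamma>" and \<psi>: "\<And>i. \<psi> i \<in> \<Gamma>" "\<And>i. \<psi> i \<in> x (Suc i)"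
    and max: "\<And>i z. R (x i) z \<Longrightarrow> \<psi> i \<in> z \<Longrightarrow> always (x (Suc i)) \<subseteq> z \<Longrightarrow> always z \<subseteq> always (x (Suc i))"
    and fresh: "\<And>i j. j \<le> i \<Longrightarrow> R (x i) (x j) \<Longrightarrow> \<psi> i \<notin> x j"
  shows False
proof -
  have mcs_x: "mcs (x i)" for i
    using step RD(1) by blast
  have reach: "R\<^sup>*\<^sup>* (x i) (x j)" if "i \<le> j" for i j
    using that by (induction rule: dec_induct) (auto intro: rtranclp.rtrancl_into_rtrancl step)
  \<comment> \<open>A repeated point would be an earlier visible witness for the same
    demand.\<close>
  have "x j \<noteq> x (Suc i)" if "j \<le> i" for i j
    using fresh[OF that] step[of i] \<psi>(2)[of i] by auto
  then have neq: "x i \<noteq> x j" if "i < j" for i j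
    using that by (cases j) auto
  have inj: "inj x"
    by (rule injI) (metis neq nat_neq_iff)
  have "\<exists>i. infinite {j. R (x i) (x j) \<and> \<psi> i \<in> x j}"
    using later_demand[of x R \<Gamma> \<psi> "\<lambda>w. w" bound] inj step fin \<psi> no_unseen_chain_reach[OF reach]
    by (simp add: unseen_def)
  then obtain i where i: "infinite {j. R (x i) (x j) \<and> \<psi> i \<in> x j}"
    by blast
  \<comment> \<open>The demand of \<open>x i\<close> recurs at some visible \<open>x j\<close>
    beyond \<open>x a\<close>, and \<open>always\<close> only grows on the way there; maximality of
    the witness \<open>x (Suc i)\<close> bounds it from above.\<close>
  have returns: "always (x a) \<subseteq> always (x (Suc i))" if "Suc i \<le> a" for a
  proof -
    obtain j where j: "a \<le> j" "R (x i) (x j)" "\<psi> i \<in> x j"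
      using i unfolding infinite_nat_iff_unbounded_le by blast
    have "always (x (Suc i)) \<subseteq> x j"
      using always_reach[OF reach[of "Suc i" j]] always_subset that j(1) by fastforce
    then show ?thesis
      using max[OF j(2,3)] always_reach[OF reach[OF j(1)]] by blast
  qed
  define x' where "x' k = x (Suc i + k)" for k
  have "\<not> chain R (unseen (x' a)) bound (x' b)" for a b
  proof (rule no_unseen_chain)
    show "always (x' a) \<subseteq> x' b"
      using returns[of "Suc i + a"] always_reach[OF reach[of "Suc i" "Suc i + b"]] always_subset
      unfolding x'_def by fastforce
  qed (simp_all add: x'_def mcs_x)
  moreover have "inj x'"
  proof (rule injI)
    fix a b assume "x' a = x' b"
    then have "Suc i + a = Suc i + b"
      unfolding x'_def by (rule injD[OF inj])
    then show "a = b"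
      by simp
  qed
  moreover have "R (x' k) (x' (Suc k))" "\<psi> (Suc i + k) \<in> x' (Suc k)" for k
    using step[of "Suc i + k"] \<psi>(2)[of "Suc i + k"] by (simp_all add: x'_def)
  ultimately obtain a b where "b \<le> a" "R (x' a) (x' b)" "\<psi> (Suc i + a) \<in> x' b"
    using earlier_demand[of x' R \<Gamma> "\<lambda>k. \<psi> (Suc i + k)" "\<lambda>w. w" bound] fin \<psi>(1)
    unfolding unseen_def by blast
  then show False
    using fresh[of "Suc i + b" "Suc i + a"] by (auto simp: x'_def)
qed

text \<open>A tree of paths is grown, with a new witness only if no visible point of the path
  serves. \<open>W\<close> forgets the paths and keeps their points.\<close>

lemma finite_witness_closed:
  assumes "mcs x0" "finite \<Gamma>"
  obtains W where "finite W" "x0 \<in> W" "\<And>v. v \<in> W \<Longrightarrow> mcs v"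
    and "\<And>v c. v \<in> W \<Longrightarrow> c \<in> \<Gamma> \<Longrightarrow> Dia c \<in> v \<Longrightarrow> \<exists>u\<in>W. R v u \<and> c \<in> u"
proof -
  define good where "good x c y \<longleftrightarrow> R x y \<and> c \<in> y \<and>
    (\<forall>z. R x z \<longrightarrow> c \<in> z \<longrightarrow> always y \<subseteq> z \<longrightarrow> always z \<subseteq> always y)" for x c y
  have "\<forall>x c. \<exists>y. mcs x \<and> Dia c \<in> x \<longrightarrow> good x c y"
    using maximal_successor by (simp add: good_def)
  then obtain pick where pick: "\<And>x c. mcs x \<Longrightarrow> Dia c \<in> x \<Longrightarrow> good x c (pick x c)"
    by metis
  define succs where "succs q = (\<lambda>c. q @ [pick (last q) c]) `
    {c\<in>\<Gamma>. Dia c \<in> last q \<and> mcs (last q) \<and> \<not> (\<exists>v\<in>set q. R (last q) v \<and> c \<in> v)}" for q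
  have fin_succs: "finite (succs q)" for q
    using assms(2) by (simp add: succs_def)
  have no_path: "\<not> (\<forall>k. f (Suc k) \<in> succs (f k))" if "f 0 = [x0]" for f
  proof
    assume path: "\<forall>k. f (Suc k) \<in> succs (f k)"
    define x where "x k = last (f k)" for k
    have "\<exists>c. c \<in> \<Gamma> \<and> Dia c \<in> x k \<and> mcs (x k) \<and> (\<forall>v\<in>set (f k). R (x k) v \<longrightarrow> c \<notin> v) \<and>
        f (Suc k) = f k @ [pick (x k) c]" for k
      using path[rule_format, of k] unfolding succs_def x_def by blast
    then obtain \<psi> where \<psi>: "\<And>k. \<psi> k \<in> \<Gamma>" "\<And>k. Dia (\<psi> k) \<in> x k" "\<And>k. mcs (x k)"
      "\<And>k v. v \<in> set (f k) \<Longrightarrow> R (x k) v \<Longrightarrow> \<psi> k \<notin> v"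
      "\<And>k. f (Suc k) = f k @ [pick (x k) (\<psi> k)]"
      by metis
    have good_x: "good (x k) (\<psi> k) (x (Suc k))" for k
      using pick[OF \<psi>(3,2)] \<psi>(5)[of k] by (simp add: x_def)
    have "f k \<noteq> []" for k
      using that \<psi>(5) by (cases k) auto
    then have "x j \<in> set (f j)" for j
      by (simp add: x_def)
    moreover have "set (f j) \<subseteq> set (f k)" if "j \<le> k" for j k
      using that by (induction rule: dec_induct) (auto simp: \<psi>(5))
    ultimately have "x j \<in> set (f k)" if "j \<le> k" for j k
      using that by blast
    then have "R (x i) (x j) \<Longrightarrow> \<psi> i \<notin> x j" if "j \<le> i" for i j
      using that \<psi>(4) by blast
    moreover have "always z \<subseteq> always (x (Suc i))"
      if "R (x i) z" "\<psi> i \<in> z" "always (x (Suc i)) \<subseteq> z" for i z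
      using good_x[of i] that unfolding good_def by blast
    moreover have "R (x i) (x (Suc i))" "\<psi> i \<in> x (Suc i)" for i
      using good_x[of i] unfolding good_def by blast+
    ultimately show False
      using no_infinite_selection[of x \<Gamma> \<psi>] assms(2) \<psi>(1) by metis
  qed
  let ?Q = "{q. (\<lambda>q q'. q' \<in> succs q)\<^sup>*\<^sup>* [x0] q}"
  have finQ: "finite ?Q"
    using finite_reachable[of succs "[x0]"] fin_succs no_path by blast
  \<comment> \<open>Every point on a path also ends some path of the tree, so its demands have been
    treated.\<close>
  have Q: "q \<noteq> [] \<and> (\<forall>v\<in>set q. mcs v \<and> (\<exists>q'\<in>?Q. last q' = v))" if "q \<in> ?Q" for q
    using that[unfolded mem_Collect_eq]
  proof (induction rule: rtranclp_induct)
    case base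
    then show ?case
      using assms(1) by auto
  next
    case (step q q')
    then obtain c where c: "Dia c \<in> last q" "mcs (last q)" "q' = q @ [pick (last q) c]"
      by (auto simp: succs_def)
    have "mcs (pick (last q) c)"
      using pick[OF c(2,1)] RD(2) by (auto simp: good_def)
    moreover have "q' \<in> ?Q"
      using rtranclp.rtrancl_into_rtrancl[OF step(1,2)] by simp
    ultimately show ?case
      using step.IH c(3) by auto
  qed
  define W where "W = \<Union> (set ` ?Q)"
  have "\<exists>u\<in>W. R v u \<and> c \<in> u" if v: "v \<in> W" "c \<in> \<Gamma>" "Dia c \<in> v" for v c
  proof -
    obtain q where q: "q \<in> ?Q" "last q = v" "mcs v"
      using v(1) Q unfolding W_def by blast
    show ?thesis
    proof (cases "\<exists>u\<in>set q. R v u \<and> c \<in> u")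
      case True
      then show ?thesis
        using q(1) unfolding W_def by blast
    next
      case False
      then have "q @ [pick v c] \<in> succs q"
        using v q by (auto simp: succs_def)
      then have "q @ [pick v c] \<in> ?Q"
        using q(1) rtranclp.rtrancl_into_rtrancl[of "\<lambda>q q'. q' \<in> succs q" "[x0]" q] by simp
      then have "pick v c \<in> W"
        unfolding W_def by fastforce
      then show ?thesis
        using pick[OF q(3) v(3)] by (auto simp: good_def)
    qed
  qed
  moreover have "finite W" "x0 \<in> W" "\<And>v. v \<in> W \<Longrightarrow> mcs v"
    using finQ Q unfolding W_def by (blast, fastforce, blast)
  ultimately show ?thesis
    using that by blast
qed

text \<open>One formula of \<open>I\<close> covers the worlds in \<open>V p\<close>, and positivity
  transfers the truth of \<open>\<gamma>\<close> from the subframe to the canonical model. The two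
  axioms use this with different \<open>I\<close>.\<close>

lemma finite_subframe_unseen:
  assumes F: "finite (worlds F)" "\<And>v. v \<in> worlds F \<Longrightarrow> mcs v"
    and acc: "\<And>u v. (u, v) \<in> acc F \<longleftrightarrow> u \<in> worlds F \<and> v \<in> worlds F \<and> R u v"
    and x: "x \<in> worlds F" "sat F V x \<gamma>"
    and I: "\<And>a b. a \<in> I \<Longrightarrow> b \<in> I \<Longrightarrow> Or a b \<in> I" "Bot \<in> I"
    and P: "\<And>v. v \<in> worlds F \<Longrightarrow> v \<in> V p \<Longrightarrow> \<exists>a\<in>I. a \<in> v"
  shows "\<exists>a\<in>I. subst_all a \<gamma> \<in> x"
proof -
  have "\<exists>a\<in>I. \<forall>v\<in>worlds F \<inter> V p. a \<in> v"
    using ideal_common[of I Bot "worlds F \<inter> V p" "\<lambda>v. v"] I F P by auto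
  then obtain a where a: "a \<in> I" "\<And>v. v \<in> worlds F \<Longrightarrow> v \<in> V p \<Longrightarrow> a \<in> v"
    by blast
  have "subst_all a \<gamma> \<in> (\<lambda>v. v) x"
    by (rule sp_sat_generated[OF sp x(2), of "worlds F"]) (use x F acc a in auto)
  then show ?thesis
    using a(1) by blast
qed

end

section \<open>Finite models\<close>

lemma sat_bool_eval: "sat F V w a = bool_eval (sat F V w) a"
  by (induction a) auto

lemma sat_subst: "sat F V w (subst s a) = sat F (\<lambda>n. {u. sat F V u (s n)}) w a"
  by (induction a arbitrary: w) auto

lemma sat_cong:
  "w \<in> worlds F \<Longrightarrow> (\<And>n. V n \<inter> worlds F = V' n \<inter> worlds F) \<Longrightarrow> sat F V w a = sat F V' w a"
proof (induction a arbitrary: w)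
  case (Var n)
  then show ?case
    by (metis IntD1 IntI sat.simps(1))
qed auto

lemma normal_logic_valid: "normal_logic {a. valid_in F a}"
  unfolding normal_logic_def
proof (intro conjI allI impI)
  fix a assume "tautology a"
  then show "a \<in> {a. valid_in F a}"
    by (auto simp: tautology_def valid_in_def sat_bool_eval[of F _ _ a])
next
  fix s a assume "a \<in> {a. valid_in F a}"
  then show "subst s a \<in> {a. valid_in F a}"
    by (auto simp: valid_in_def sat_subst)
qed (auto simp: valid_in_def)

lemma add_axiom_sound: "valid_in F c \<Longrightarrow> a \<in> add_axiom logic_K c \<Longrightarrow> valid_in F a"
  using normal_logic_valid[of F] unfolding add_axiom_def logic_K_def by blast

lemma normal_logic_Inter: "(\<And>M. M \<in> A \<Longrightarrow> normal_logic M) \<Longrightarrow> normal_logic (\<Inter>A)"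
  unfolding normal_logic_def by (safe; blast)

lemma normal_add_axiom: "normal_logic (add_axiom logic_K c)" "c \<in> add_axiom logic_K c"
  unfolding add_axiom_def by (auto intro: normal_logic_Inter)

lemma valid_in_image:
  assumes F: "kripke_frame F" and g: "inj_on g (worlds F)"
  shows "valid_in \<lparr>worlds = g ` worlds F, acc = map_prod g g ` acc F\<rparr> a \<longleftrightarrow> valid_in F a"
    (is "valid_in ?G a \<longleftrightarrow> _")
proof -
  have acc: "(g u, g v) \<in> acc ?G \<longleftrightarrow> (u, v) \<in> acc F" if "u \<in> worlds F" "v \<in> worlds F" for u v
  proof
    assume "(g u, g v) \<in> acc ?G"
    then obtain u' v' where "(u', v') \<in> acc F" "g u = g u'" "g v = g v'"
      by auto
    moreover from this(1) have "u' \<in> worlds F" "v' \<in> worlds F"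
      using F by (auto simp: kripke_frame_def)
    ultimately show "(u, v) \<in> acc F"
      using that inj_onD[OF g, of u u'] inj_onD[OF g, of v v'] by simp
  qed (auto intro: image_eqI[of _ _ "(u, v)"])
  have sat: "sat ?G V (g u) b \<longleftrightarrow> sat F (\<lambda>n. {u. g u \<in> V n}) u b" if "u \<in> worlds F" for V u b
    using that by (induction b arbitrary: u) (use acc in auto)
  show ?thesis
  proof
    assume G: "valid_in ?G a"
    show "valid_in F a"
      unfolding valid_in_def
    proof (intro allI ballI)
      fix V w assume w: "w \<in> worlds F"
      have "sat ?G (\<lambda>n. g ` (V n \<inter> worlds F)) (g w) a"
        using G w by (auto simp: valid_in_def)
      then have "sat F (\<lambda>n. {u. g u \<in> g ` (V n \<inter> worlds F)}) w a"
        using sat w by simp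
      moreover have "{u. g u \<in> g ` (V n \<inter> worlds F)} \<inter> worlds F = V n \<inter> worlds F" for n
        using g by (auto dest: inj_onD)
      ultimately show "sat F V w a"
        using sat_cong[OF w, of "\<lambda>n. {u. g u \<in> g ` (V n \<inter> worlds F)}" V] by simp
    qed
  next
    assume "valid_in F a"
    then show "valid_in ?G a"
      using sat by (auto simp: valid_in_def)
  qed
qed

text \<open>The class consists of all finite frames validating \<open>c\<close>, so soundness is
  automatic; countermodels over another type of worlds are renamed into the natural numbers.\<close>

lemma finite_model_propertyI:
  fixes c :: fm
  assumes "\<And>a. a \<notin> add_axiom logic_K c \<Longrightarrow>
    \<exists>F :: 'w kframe. kripke_frame F \<and> finite (worlds F) \<and> valid_in F c \<and> \<not> valid_in F a"
  shows "finite_model_property (add_axiom logic_K c)"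
  unfolding finite_model_property_def
proof (intro exI conjI)
  let ?C = "{F :: nat kframe. kripke_frame F \<and> finite (worlds F) \<and> valid_in F c}"
  show "\<forall>F\<in>?C. kripke_frame F \<and> finite (worlds F)"
    by blast
  have "\<exists>F\<in>?C. \<not> valid_in F a" if a: "a \<notin> add_axiom logic_K c" for a
  proof -
    obtain F :: "'w kframe" where F: "kripke_frame F" "finite (worlds F)" "valid_in F c" "\<not> valid_in F a"
      using assms[OF a] by blast
    obtain g :: "'w \<Rightarrow> nat" where g: "inj_on g (worlds F)"
      using finite_imp_inj_to_nat_seg[OF F(2)] by blast
    let ?G = "\<lparr>worlds = g ` worlds F, acc = map_prod g g ` acc F\<rparr>"
    have "kripke_frame ?G"
      using F(1) unfolding kripke_frame_def by auto
    then have "?G \<in> ?C"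
      using F valid_in_image[OF F(1) g] by simp
    moreover have "\<not> valid_in ?G a"
      using F valid_in_image[OF F(1) g] by simp
    ultimately show ?thesis
      by blast
  qed
  then show "add_axiom logic_K c = {a. \<forall>F\<in>?C. valid_in F a}"
    using add_axiom_sound by blast
qed

primrec dia_args :: "fm \<Rightarrow> fm set" where
  "dia_args (Var n) = {}"
| "dia_args Bot = {}"
| "dia_args (Imp a b) = dia_args a \<union> dia_args b"
| "dia_args (Dia a) = insert a (dia_args a)"

lemma finite_dia_args: "finite (dia_args a)"
  by (induction a) auto

context modal_logic
begin

text \<open>The map \<open>f\<close> allows several worlds over one canonical point, as for the tree
  of paths below. The frame may omit canonical arrows as long as the demands in
  \<open>\<Gamma>\<close> keep witnesses.\<close>

lemma truth_lemma:
  assumes "\<And>u. u \<in> worlds F \<Longrightarrow> mcs (f u)"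
    and "\<And>u v. (u, v) \<in> acc F \<Longrightarrow> R (f u) (f v)"
    and "\<And>u c. u \<in> worlds F \<Longrightarrow> c \<in> \<Gamma> \<Longrightarrow> Dia c \<in> f u \<Longrightarrow>
      \<exists>v\<in>worlds F. (u, v) \<in> acc F \<and> c \<in> f v"
    and "u \<in> worlds F" "dia_args b \<subseteq> \<Gamma>"
  shows "sat F (\<lambda>n. {u. Var n \<in> f u}) u b \<longleftrightarrow> b \<in> f u"
  using assms(4,5)
proof (induction b arbitrary: u)
  case (Dia b)
  show ?case
  proof
    assume "sat F (\<lambda>n. {u. Var n \<in> f u}) u (Dia b)"
    then obtain v where "v \<in> worlds F" "(u, v) \<in> acc F" "sat F (\<lambda>n. {u. Var n \<in> f u}) v b"
      by auto
    then show "Dia b \<in> f u"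
      using Dia RD(3)[OF assms(2)] by auto
  next
    assume "Dia b \<in> f u"
    then obtain v where "v \<in> worlds F" "(u, v) \<in> acc F" "b \<in> f v"
      using Dia.prems assms(3)[of u b] by auto
    then show "sat F (\<lambda>n. {u. Var n \<in> f u}) u (Dia b)"
      using Dia by auto
  qed
qed (use assms(1) in auto)

lemma L_Imp_Or: "Imp a b \<in> L \<Longrightarrow> Imp a (Or b c) \<in> L"
  by (rule mcs_complete) (use mcs_L in force)

lemma refuting_mcs:
  assumes "a \<notin> L"
  obtains w where "mcs w" "a \<notin> w"
  using lindenbaum[OF closed_L assms] by blast

end

section \<open>Finite subframes and the validity of the axioms\<close>

context weakly_transitive_logic
begin

lemma finite_countermodel:
  assumes "a \<notin> L"
  obtains F :: "fm set kframe" where "kripke_frame F" "finite (worlds F)" "\<not> valid_in F a"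
    and "\<And>v. v \<in> worlds F \<Longrightarrow> mcs v"
    and "\<And>u v. (u, v) \<in> acc F \<longleftrightarrow> u \<in> worlds F \<and> v \<in> worlds F \<and> R u v"
proof -
  obtain x0 where x0: "mcs x0" "a \<notin> x0"
    using refuting_mcs[OF assms] by blast
  obtain W where W: "finite W" "x0 \<in> W" "\<And>v. v \<in> W \<Longrightarrow> mcs v"
    "\<And>v c. v \<in> W \<Longrightarrow> c \<in> dia_args a \<Longrightarrow> Dia c \<in> v \<Longrightarrow> \<exists>u\<in>W. R v u \<and> c \<in> u"
    using finite_witness_closed[OF x0(1) finite_dia_args[of a]] by blast
  define F where "F = \<lparr>worlds = W, acc = {(u, v). u \<in> W \<and> v \<in> W \<and> R u v}\<rparr>"
  have "sat F (\<lambda>n. {u. Var n \<in> (\<lambda>v. v) u}) x0 a \<longleftrightarrow> a \<in> (\<lambda>v. v) x0"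
    by (rule truth_lemma[where \<Gamma> = "dia_args a"]) (use W in \<open>auto simp: F_def\<close>)
  then have "\<not> valid_in F a"
    using x0(2) W(2) by (auto simp: valid_in_def F_def)
  moreover have "kripke_frame F"
    using W(2) by (auto simp: kripke_frame_def F_def)
  ultimately show ?thesis
    using that[of F] W by (simp add: F_def)
qed

text \<open>If the axiom failed at \<open>x\<close>, all worlds in \<open>V p\<close> would be
  unseen from \<open>x\<close>, hence covered by one formula of the ideal, against the axiom in the
  canonical model.\<close>

lemma finite_subframe_valid:
  assumes F: "finite (worlds F)" "\<And>v. v \<in> worlds F \<Longrightarrow> mcs v"
    and acc: "\<And>u v. (u, v) \<in> acc F \<longleftrightarrow> u \<in> worlds F \<and> v \<in> worlds F \<and> R u v"
  shows "valid_in F (Imp \<gamma> (Or (Dia (Var p)) (Var p)))"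
  unfolding valid_in_def
proof (intro allI ballI)
  fix V x assume x: "x \<in> worlds F"
  have False if *: "sat F V x \<gamma>" "x \<notin> V p" "\<And>y. y \<in> worlds F \<Longrightarrow> R x y \<Longrightarrow> y \<notin> V p"
  proof -
    have "mcs x"
      using x F by blast
    have "\<exists>a\<in>ideal x. subst_all a \<gamma> \<in> x"
    proof (rule finite_subframe_unseen[OF F acc x *(1)])
      show "Or a b \<in> ideal x" if "a \<in> ideal x" "b \<in> ideal x" for a b
        using ideal_Or[OF \<open>mcs x\<close> that] .
      show "Bot \<in> ideal x"
        by (rule ideal_Bot[OF \<open>mcs x\<close>])
      fix v assume "v \<in> worlds F" "v \<in> V p"
      then have "v \<in> unseen x"
        using * by (auto simp: unseen_def)
      then show "\<exists>a\<in>ideal x. a \<in> v"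
        using unseen_ideal[OF \<open>mcs x\<close> F(2)[OF \<open>v \<in> worlds F\<close>]] by blast
    qed
    then show False
      using ax_instance[OF \<open>mcs x\<close>] by blast
  qed
  then show "sat F V x (Imp \<gamma> (Or (Dia (Var p)) (Var p)))"
    using x acc by auto
qed

text \<open>For this axiom a failure at \<open>x\<close> allows \<open>x\<close> itself to lie in
  \<open>V p\<close>, so the ideal is replaced by all formulas that fail at every successor of
  \<open>x\<close>.\<close>

lemma finite_subframe_valid_Dia:
  assumes F: "finite (worlds F)" "\<And>v. v \<in> worlds F \<Longrightarrow> mcs v"
    and acc: "\<And>u v. (u, v) \<in> acc F \<longleftrightarrow> u \<in> worlds F \<and> v \<in> worlds F \<and> R u v"
    and ax_Dia: "Imp \<gamma> (Dia (Var p)) \<in> L"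
  shows "valid_in F (Imp \<gamma> (Dia (Var p)))"
  unfolding valid_in_def
proof (intro allI ballI)
  fix V x assume x: "x \<in> worlds F"
  have False if *: "sat F V x \<gamma>" "\<And>y. y \<in> worlds F \<Longrightarrow> R x y \<Longrightarrow> y \<notin> V p"
  proof -
    have "mcs x"
      using x F by blast
    have "\<exists>a\<in>{a. Dia a \<notin> x}. subst_all a \<gamma> \<in> x"
    proof (rule finite_subframe_unseen[OF F acc x *(1)])
      show "Or a b \<in> {a. Dia a \<notin> x}" if "a \<in> {a. Dia a \<notin> x}" "b \<in> {a. Dia a \<notin> x}" for a b
        using that mcs_Dia_Or[OF \<open>mcs x\<close>] by auto
      show "Bot \<in> {a. Dia a \<notin> x}"
        using mcs_Dia_Bot[OF \<open>mcs x\<close>] by simp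
      fix v assume v: "v \<in> worlds F" "v \<in> V p"
      then have "\<not> R x v"
        using * by blast
      then show "\<exists>a\<in>{a. Dia a \<notin> x}. a \<in> v"
        using not_R[OF \<open>mcs x\<close> F(2)[OF v(1)]] by auto
    qed
    then obtain a where a: "Dia a \<notin> x" "subst_all a \<gamma> \<in> x"
      by blast
    have "subst_all a (Imp \<gamma> (Dia (Var p))) \<in> x"
      unfolding subst_all_def using mcs_L[OF \<open>mcs x\<close>] L_subst ax_Dia by blast
    then show False
      using a \<open>mcs x\<close> by simp
  qed
  then show "sat F V x (Imp \<gamma> (Dia (Var p)))"
    using x acc by auto
qed

end

lemma modal_logic_add_axiom: "modal_logic (add_axiom logic_K c)"
  by standard (rule normal_add_axiom)

theorem fmp_wK4:
  assumes "strictly_positive p \<gamma>" "0 \<notin> depths p \<gamma>" "1 \<notin> depths p \<gamma>"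
  shows "finite_model_property (wK4 p \<gamma>)"
  unfolding wK4_def
proof (rule finite_model_propertyI)
  let ?ax = "Imp \<gamma> (Or (Dia (Var p)) (Var p))"
  interpret weakly_transitive_logic "add_axiom logic_K ?ax" p \<gamma>
    using assms normal_add_axiom by unfold_locales
  fix a assume "a \<notin> add_axiom logic_K ?ax"
  then obtain F where F: "kripke_frame F" "finite (worlds F)" "\<not> valid_in F a"
    "\<And>v. v \<in> worlds F \<Longrightarrow> mcs v"
    "\<And>u v. (u, v) \<in> acc F \<longleftrightarrow> u \<in> worlds F \<and> v \<in> worlds F \<and> R u v"
    using finite_countermodel by blast
  then show "\<exists>F :: fm set kframe. kripke_frame F \<and> finite (worlds F) \<and> valid_in F ?ax \<and> \<not> valid_in F a"
    using finite_subframe_valid[OF F(2,4,5)] by blast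
qed

text \<open>The logic contains the axiom of \<open>wK4\<close>, so the same selection applies; only
  the validity of the axiom is argued separately.\<close>

theorem fmp_K4:
  assumes "strictly_positive p \<gamma>" "0 \<notin> depths p \<gamma>" "1 \<notin> depths p \<gamma>"
  shows "finite_model_property (K4 p \<gamma>)"
  unfolding K4_def
proof (rule finite_model_propertyI)
  let ?ax = "Imp \<gamma> (Dia (Var p))"
  have "Imp \<gamma> (Or (Dia (Var p)) (Var p)) \<in> add_axiom logic_K ?ax"
    by (rule modal_logic.L_Imp_Or[OF modal_logic_add_axiom normal_add_axiom(2)])
  then interpret weakly_transitive_logic "add_axiom logic_K ?ax" p \<gamma>
    using assms normal_add_axiom(1) by unfold_locales
  fix a assume "a \<notin> add_axiom logic_K ?ax"
  then obtain F where F: "kripke_frame F" "finite (worlds F)" "\<not> valid_in F a"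
    "\<And>v. v \<in> worlds F \<Longrightarrow> mcs v"
    "\<And>u v. (u, v) \<in> acc F \<longleftrightarrow> u \<in> worlds F \<and> v \<in> worlds F \<and> R u v"
    using finite_countermodel by blast
  then show "\<exists>F :: fm set kframe. kripke_frame F \<and> finite (worlds F) \<and> valid_in F ?ax \<and> \<not> valid_in F a"
    using finite_subframe_valid_Dia[OF F(2,4,5) normal_add_axiom(2)] by blast
qed

section \<open>Selection for logics of Loeb type\<close>

locale gl_logic = modal_logic +
  fixes p :: nat and \<beta> :: fm
  assumes sp: "strictly_positive p \<beta>" and deep: "0 \<notin> depths p \<beta>"
    and ax: "Imp (Dia (Var p)) (Dia (And (Var p) (Neg \<beta>))) \<in> L"
begin

section \<open>Consequences of the axiom of Loeb type\<close>

lemma gl_instance: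
  assumes "mcs x" "Dia c \<in> x"
  obtains y where "R x y" "c \<in> y" "subst_all c \<beta> \<notin> y"
proof -
  have "subst_all c (Imp (Dia (Var p)) (Dia (And (Var p) (Neg \<beta>)))) \<in> x"
    unfolding subst_all_def using mcs_L[OF assms(1)] L_subst ax by blast
  then have "Dia (And c (Neg (subst_all c \<beta>))) \<in> x"
    using assms by simp
  then obtain y where "R x y" "And c (Neg (subst_all c \<beta>)) \<in> y"
    using R_successor[OF assms(1)] by blast
  then show ?thesis
    using that[of y] RD(2)[of x y] by auto
qed

lemma sp_mono:
  assumes "strictly_positive p \<sigma>" "\<And>z. mcs z \<Longrightarrow> a \<in> z \<Longrightarrow> b \<in> z" "mcs w" "subst_all a \<sigma> \<in> w"
  shows "subst_all b \<sigma> \<in> w"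
  using assms(1,3,4)
proof (induction arbitrary: w rule: strictly_positive.induct)
  case (4 s)
  then show ?case
    using mcs_Dia_mono[of w "subst_all a s" "subst_all b s"] by simp
qed (use assms(2) in auto)

text \<open>The axiom is applied to the disjunction \<open>?q\<close> of \<open>a\<close> and
  \<open>subst_all a \<beta>\<close>. The point it provides lacks \<open>a\<close>, so it contains
  \<open>subst_all a \<beta>\<close> and by monotonicity also \<open>subst_all ?q \<beta>\<close>,
  which it was chosen to refute.\<close>

lemma gl_transitive:
  assumes "mcs x" "Dia (subst_all a \<beta>) \<in> x"
  shows "Dia a \<in> x"
proof (rule ccontr)
  assume a: "Dia a \<notin> x"
  let ?q = "Or a (subst_all a \<beta>)"
  have "Dia ?q \<in> x"
    using mcs_Dia_mono[OF assms, of ?q] by simp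
  then obtain y where y: "R x y" "?q \<in> y" "subst_all ?q \<beta> \<notin> y"
    using gl_instance[OF assms(1)] by blast
  have "mcs y"
    using y(1) RD(2) by blast
  have "a \<notin> y"
    using a RD(3)[OF y(1)] by blast
  then have "subst_all a \<beta> \<in> y"
    using y(2) \<open>mcs y\<close> by simp
  then have "subst_all ?q \<beta> \<in> y"
    using sp_mono[OF sp _ \<open>mcs y\<close>, of a ?q] by simp
  then show False
    using y(3) by simp
qed

definition bound :: nat where
  "bound = size \<beta>"

text \<open>
  The set in the chain condition is not definable, so the axiom is applied to finite disjunctions
  and compactness of the canonical model gives the rest.
\<close>

lemma gl_successor:
  assumes x: "mcs x" and c: "Dia c \<in> x"
  shows "\<exists>y. R x y \<and> c \<in> y \<and> \<not> chain R {z. c \<in> z \<or> \<not> R x z} bound y"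
proof -
  \<comment> \<open>The formulas that imply \<open>c\<close> at every successor of \<open>x\<close>;
    among them are \<open>c\<close> and all formulas that fail at every successor.\<close>
  define I where "I = {a. Dia (And a (Neg c)) \<notin> x}"
  have I_Or: "Or a b \<in> I" if "a \<in> I" "b \<in> I" for a b
  proof (rule ccontr)
    assume "Or a b \<notin> I"
    then have "Dia (Or (And a (Neg c)) (And b (Neg c))) \<in> x"
      using mcs_Dia_mono[OF x, of "And (Or a b) (Neg c)" "Or (And a (Neg c)) (And b (Neg c))"]
      by (auto simp: I_def)
    then show False
      using mcs_Dia_Or[OF x] that by (auto simp: I_def)
  qed
  have cI: "c \<in> I"
    using mcs_Dia_mono[OF x, of "And c (Neg c)" Bot] mcs_Dia_Bot[OF x] by (auto simp: I_def)
  have I_bound: "\<exists>b\<in>I. \<forall>a\<in>insert c A. \<forall>z. mcs z \<longrightarrow> a \<in> z \<longrightarrow> b \<in> z" if "finite A" "A \<subseteq> I" for A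
    using that
  proof (induction A)
    case empty
    then show ?case
      using cI by auto
  next
    case (insert a A)
    then obtain b where b: "b \<in> I" "\<And>a z. a \<in> insert c A \<Longrightarrow> mcs z \<Longrightarrow> a \<in> z \<Longrightarrow> b \<in> z"
      by blast
    have "Or a b \<in> z" if "a' \<in> insert c (insert a A)" "mcs z" "a' \<in> z" for a' z
      using that b(2)[of a' z] by auto
    then show ?case
      using I_Or[of a b] b(1) insert.prems by blast
  qed
  let ?B = "{d. Neg (Dia (Neg d)) \<in> x}"
  let ?N = "\<lambda>a. Neg (chain_fm bound a)"
  obtain y where y: "mcs y" "(?B \<union> {c}) \<union> ?N ` I \<subseteq> y"
  proof (rule mcs_compact)
    fix S' assume S': "finite S'" "S' \<subseteq> (?B \<union> {c}) \<union> ?N ` I"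
    have "finite (S' \<inter> ?N ` I)" "S' \<inter> ?N ` I \<subseteq> ?N ` I"
      using S'(1) by auto
    then obtain A where A: "A \<subseteq> I" "finite A" "S' \<inter> ?N ` I = ?N ` A"
      using finite_subset_image by metis
    then obtain b where b: "b \<in> I" "\<And>a z. a \<in> insert c A \<Longrightarrow> mcs z \<Longrightarrow> a \<in> z \<Longrightarrow> b \<in> z"
      using I_bound[OF A(2,1)] by blast
    \<comment> \<open>\<open>c\<close> implies \<open>b\<close>, so the axiom applies to
      \<open>b\<close>; as \<open>b\<close> lies in \<open>I\<close>, the point obtained contains
      \<open>c\<close>.\<close>
    have "Dia b \<in> x"
      using mcs_Dia_mono[OF x c, of b] b(2) by blast
    then obtain y where y: "R x y" "b \<in> y" "subst_all b \<beta> \<notin> y"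
      using gl_instance[OF x] by blast
    have "mcs y"
      using y(1) RD(2) by blast
    have "c \<in> y"
    proof (rule ccontr)
      assume "c \<notin> y"
      then have "And b (Neg c) \<in> y"
        using y(2) \<open>mcs y\<close> by simp
      then show False
        using b(1) RD(3)[OF y(1)] by (auto simp: I_def)
    qed
    moreover have "?N a \<in> y" if "a \<in> A" for a
    proof -
      have "chain_fm bound a \<notin> y"
      proof
        assume "chain_fm bound a \<in> y"
        then have "chain R {z. a \<in> z} bound y"
          using mcs_chain[OF \<open>mcs y\<close>] by simp
        from chain_mcs[OF this] have "chain R {z. b \<in> z} bound y"
          by (rule chain_weaken) (use b(2) that in blast)
        then show False
          using sp_of_chain[OF sp deep \<open>mcs y\<close>] y(3) by (simp add: bound_def)
      qed
      then show ?thesis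
        using \<open>mcs y\<close> by simp
    qed
    moreover have "d \<in> y" if "d \<in> ?B" for d
      using that RD(3)[OF y(1), of "Neg d"] x \<open>mcs y\<close> by auto
    ultimately have *: "?B \<union> {c} \<subseteq> y" "?N ` A \<subseteq> y"
      by blast+
    have "S' \<subseteq> y"
    proof
      fix s assume s: "s \<in> S'"
      show "s \<in> y"
      proof (cases "s \<in> ?N ` I")
        case True
        then have "s \<in> ?N ` A"
          using s unfolding A(3)[symmetric] by (rule IntI[rotated])
        then show ?thesis
          by (rule subsetD[OF *(2)])
      next
        case False
        then have "s \<in> ?B \<union> {c}"
          using subsetD[OF S'(2) s] by (simp only: Un_iff simp_thms)
        then show ?thesis
          by (rule subsetD[OF *(1)])
      qed
    qed
    then show "\<exists>w. mcs w \<and> S' \<subseteq> w"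
      using \<open>mcs y\<close> by blast
  qed
  have "R x y"
    using R_box[OF x y(1)] y(2) by blast
  moreover have "c \<in> y"
    using y(2) by blast
  moreover have "\<not> chain R {z. c \<in> z \<or> \<not> R x z} bound y"
  proof
    assume "chain R {z. c \<in> z \<or> \<not> R x z} bound y"
    from chain_mcs[OF this] have "chain R {z. \<exists>a\<in>I. a \<in> z} bound y"
    proof (rule chain_weaken)
      fix z assume "z \<in> {z \<in> {z. c \<in> z \<or> \<not> R x z}. mcs z}"
      then consider "c \<in> z" | "mcs z" "\<not> R x z"
        by blast
      then show "z \<in> {z. \<exists>a\<in>I. a \<in> z}"
      proof cases
        case 1
        then show ?thesis
          using cI by blast
      next
        case 2
        then obtain a where a: "a \<in> z" "Dia a \<notin> x"
          using not_R[OF x] by blast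
        then have "a \<in> I"
          using mcs_Dia_mono[OF x, of "And a (Neg c)" a] by (auto simp: I_def)
        then show ?thesis
          using a(1) by blast
      qed
    qed
    then obtain a where "a \<in> I" "chain R {z. a \<in> z} bound y"
      using chain_ideal[of I c bound y] I_Or cI by blast
    then have "chain_fm bound a \<in> y" "?N a \<in> y"
      using mcs_chain[OF y(1)] y(2) by auto
    then show False
      using y(1) by simp
  qed
  ultimately show ?thesis
    by blast
qed

text \<open>The number of formulas seen ahead could always be decreased: at the end \<open>w\<close>
  of a maximal chain, whatever \<open>w\<close> sees ahead is seen by \<open>x i\<close> and lacks
  the demand \<open>\<psi> i\<close>, which \<open>x i\<close> sees at
  \<open>x (Suc i)\<close>.\<close>

lemma no_infinite_selection:
  assumes step: "\<And>i. R (x i) (x (Suc i))"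
    and fin: "finite \<Gamma>" and \<psi>: "\<And>i. \<psi> i \<in> \<Gamma>" "\<And>i. \<psi> i \<in> x (Suc i)"
    and bounded: "\<And>i. \<not> chain R {z. \<psi> i \<in> z \<or> \<not> R (x i) z} N (x (Suc i))"
  shows False
proof -
  define seen where "seen i = {c\<in>\<Gamma>. \<exists>j>i. R (x i) (x j) \<and> c \<in> x j}" for i
  have "\<exists>w. seen w \<subset> seen i" for i
  proof -
    \<comment> \<open>Only forward arrows are followed, so the end \<open>w\<close> comes after
      \<open>i\<close>.\<close>
    let ?Q = "\<lambda>a b. a < b \<and> R (x a) (x b)"
    let ?P = "{j. \<psi> i \<in> x j \<or> \<not> R (x i) (x j)}"
    have "\<not> chain ?Q ?P N (Suc i)"
      using chain_map[of ?Q ?P N "Suc i" R x "{z. \<psi> i \<in> z \<or> \<not> R (x i) z}"] bounded[of i] by auto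
    moreover have "Suc i \<in> ?P"
      using \<psi>(2) by simp
    ultimately obtain w where w: "?Q\<^sup>*\<^sup>* (Suc i) w" "\<And>z. ?Q w z \<Longrightarrow> z \<notin> ?P"
      using chain_end[of "Suc i" ?P ?Q N] by blast
    from w(1) have "Suc i \<le> w"
      by (induction rule: rtranclp_induct) auto
    have "seen w \<subseteq> seen i"
    proof
      fix c assume "c \<in> seen w"
      then obtain j where j: "c \<in> \<Gamma>" "j > w" "R (x w) (x j)" "c \<in> x j"
        by (auto simp: seen_def)
      then have "R (x i) (x j)" "i < j"
        using w(2)[of j] \<open>Suc i \<le> w\<close> by auto
      then show "c \<in> seen i"
        using j by (auto simp: seen_def)
    qed
    moreover have "\<psi> i \<in> seen i"
      using \<psi> step by (auto simp: seen_def)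
    moreover have "\<psi> i \<notin> seen w"
      using w(2) by (auto simp: seen_def)
    ultimately show ?thesis
      by blast
  qed
  moreover obtain i where "\<And>w. card (seen i) \<le> card (seen w)"
    using ex_has_least_nat[of "\<lambda>_. True" _ "\<lambda>i. card (seen i)"] by auto
  moreover have "finite (seen i)" for i
    using fin by (simp add: seen_def)
  ultimately show False
    by (metis psubset_card_mono not_less)
qed

text \<open>No witness is reused, and the paths themselves, not their end points, serve as worlds;
  this makes an irreflexive frame possible.\<close>

lemma finite_selection_tree:
  assumes "mcs x0" "finite \<Gamma>"
  obtains Q where "finite Q" "[x0] \<in> Q" "\<And>q. q \<in> Q \<Longrightarrow> mcs (last q)"
    and "\<And>q c. q \<in> Q \<Longrightarrow> c \<in> \<Gamma> \<Longrightarrow> Dia c \<in> last q \<Longrightarrow>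
      \<exists>y. q @ [y] \<in> Q \<and> R (last q) y \<and> c \<in> y"
proof -
  define good where
    "good x c y \<longleftrightarrow> R x y \<and> c \<in> y \<and> \<not> chain R {z. c \<in> z \<or> \<not> R x z} bound y" for x c y
  have "\<forall>x c. \<exists>y. mcs x \<and> Dia c \<in> x \<longrightarrow> good x c y"
    using gl_successor by (simp add: good_def)
  then obtain pick where pick: "\<And>x c. mcs x \<Longrightarrow> Dia c \<in> x \<Longrightarrow> good x c (pick x c)"
    by metis
  define succs where
    "succs q = (\<lambda>c. q @ [pick (last q) c]) ` {c\<in>\<Gamma>. Dia c \<in> last q \<and> mcs (last q)}" for q
  have fin_succs: "finite (succs q)" for q
    using assms(2) by (simp add: succs_def)
  have no_path: "\<not> (\<forall>k. f (Suc k) \<in> succs (f k))" for f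
  proof
    assume path: "\<forall>k. f (Suc k) \<in> succs (f k)"
    define x where "x k = last (f k)" for k
    have "\<exists>c. c \<in> \<Gamma> \<and> Dia c \<in> x k \<and> mcs (x k) \<and> f (Suc k) = f k @ [pick (x k) c]" for k
      using path[rule_format, of k] unfolding succs_def x_def by blast
    then obtain \<psi> where \<psi>: "\<And>k. \<psi> k \<in> \<Gamma>" "\<And>k. Dia (\<psi> k) \<in> x k" "\<And>k. mcs (x k)"
      "\<And>k. f (Suc k) = f k @ [pick (x k) (\<psi> k)]"
      by metis
    have "good (x k) (\<psi> k) (x (Suc k))" for k
      using pick[OF \<psi>(3,2)] \<psi>(4)[of k] by (simp add: x_def)
    then have "R (x k) (x (Suc k))" "\<psi> k \<in> x (Suc k)"
      "\<not> chain R {z. \<psi> k \<in> z \<or> \<not> R (x k) z} bound (x (Suc k))" for k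
      by (simp_all add: good_def)
    then show False
      using no_infinite_selection[of x \<Gamma> \<psi> bound] assms(2) \<psi>(1) by blast
  qed
  let ?Q = "{q. (\<lambda>q q'. q' \<in> succs q)\<^sup>*\<^sup>* [x0] q}"
  have Q: "mcs (last q)" if "q \<in> ?Q" for q
    using that[unfolded mem_Collect_eq]
  proof (induction rule: rtranclp_induct)
    case base
    then show ?case
      using assms(1) by simp
  next
    case (step q q')
    then obtain c where "Dia c \<in> last q" "mcs (last q)" "q' = q @ [pick (last q) c]"
      by (auto simp: succs_def)
    then show ?case
      using pick[of "last q" c] RD(2) by (auto simp: good_def)
  qed
  have "\<exists>y. q @ [y] \<in> ?Q \<and> R (last q) y \<and> c \<in> y" if q: "q \<in> ?Q" "c \<in> \<Gamma>" "Dia c \<in> last q" for q c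
  proof -
    have "q @ [pick (last q) c] \<in> succs q"
      unfolding succs_def using q(2,3) Q[OF q(1)] by (intro imageI) simp
    then have "q @ [pick (last q) c] \<in> ?Q"
      using q(1) rtranclp.rtrancl_into_rtrancl[of "\<lambda>q q'. q' \<in> succs q" "[x0]" q] by simp
    then show ?thesis
      using pick[OF Q[OF q(1)] q(3)] unfolding good_def by blast
  qed
  moreover have "finite ?Q"
    using finite_reachable[of succs "[x0]"] fin_succs no_path by blast
  moreover have "[x0] \<in> ?Q"
    by simp
  ultimately show ?thesis
    using that[of ?Q] Q by presburger
qed

text \<open>A longest path \<open>y\<close> in \<open>V p\<close> seen by \<open>x\<close> is the
  witness: \<open>x\<close> does not see its extensions in \<open>V p\<close>, so one
  \<open>a\<close> that fails at all successors of \<open>last x\<close> covers them. Truth of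
  \<open>\<beta>\<close> at \<open>y\<close> would put \<open>subst_all a \<beta>\<close> into
  \<open>last y\<close>, and \<open>gl_transitive\<close> would give \<open>Dia a\<close> at
  \<open>last x\<close>.\<close>

lemma tree_valid:
  assumes F: "finite (worlds F)" "\<And>q. q \<in> worlds F \<Longrightarrow> mcs (last q)"
    and acc: "\<And>u v. (u, v) \<in> acc F \<longleftrightarrow>
      u \<in> worlds F \<and> v \<in> worlds F \<and> (\<exists>r. r \<noteq> [] \<and> v = u @ r) \<and> R (last u) (last v)"
  shows "valid_in F (Imp (Dia (Var p)) (Dia (And (Var p) (Neg \<beta>))))"
  unfolding valid_in_def
proof (intro allI ballI)
  fix V x assume x: "x \<in> worlds F"
  have "\<exists>y. (x, y) \<in> acc F \<and> y \<in> V p \<and> \<not> sat F V y \<beta>" if y0: "(x, y0) \<in> acc F" "y0 \<in> V p" for y0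
  proof -
    let ?Y = "{y. (x, y) \<in> acc F \<and> y \<in> V p}"
    have "finite ?Y" "?Y \<noteq> {}"
      using F(1) y0 by (auto simp: acc)
    then have "Max (length ` ?Y) \<in> length ` ?Y"
      by (intro Max_in) simp_all
    then obtain y where y: "y \<in> ?Y" "length y = Max (length ` ?Y)"
      by (metis (no_types, lifting) imageE)
    have longest: "length z \<le> length y" if "z \<in> ?Y" for z
      unfolding y(2) using \<open>finite ?Y\<close> that by (intro Max_ge) auto
    have xy: "x \<in> worlds F" "y \<in> worlds F" "R (last x) (last y)" "\<exists>r. r \<noteq> [] \<and> y = x @ r"
      using y(1) acc by blast+
    have "mcs (last x)"
      using F x by blast
    have "\<not> sat F V y \<beta>"
    proof
      assume sat: "sat F V y \<beta>"
      \<comment> \<open>Only proper extensions are covered by \<open>a\<close>: \<open>y\<close>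
        itself is seen by \<open>x\<close>, and \<open>\<beta>\<close> has no occurrence of
        \<open>p\<close> at depth zero.\<close>
      define X where "X = {z \<in> worlds F. \<exists>r. r \<noteq> [] \<and> z = y @ r}"
      define I where "I = {a. Dia a \<notin> last x}"
      have "\<exists>a\<in>I. \<forall>z\<in>X \<inter> V p. a \<in> last z"
      proof (rule ideal_common)
        show "Or a b \<in> I" if "a \<in> I" "b \<in> I" for a b
          using that mcs_Dia_Or[OF \<open>mcs (last x)\<close>] by (auto simp: I_def)
        show "Bot \<in> I"
          using mcs_Dia_Bot[OF \<open>mcs (last x)\<close>] by (simp add: I_def)
        show "finite (X \<inter> V p)"
          using F(1) by (simp add: X_def)
        fix z assume z: "z \<in> X \<inter> V p"
        then obtain r where r: "r \<noteq> []" "z = y @ r" "z \<in> worlds F"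
          by (auto simp: X_def)
        have "\<not> R (last x) (last z)"
        proof
          assume "R (last x) (last z)"
          moreover obtain r' where "y = x @ r'"
            using xy(4) by blast
          then have "\<exists>r. r \<noteq> [] \<and> z = x @ r"
            using r(1,2) by (intro exI[of _ "r' @ r"]) simp
          ultimately have "z \<in> ?Y"
            using xy(1) r(3) z unfolding mem_Collect_eq acc by blast
          then show False
            using longest[of z] r by simp
        qed
        then show "mcs (last z) \<and> (\<exists>a\<in>I. a \<in> last z)"
          using not_R[OF \<open>mcs (last x)\<close>] F(2)[OF r(3)] by (auto simp: I_def)
      qed
      then obtain a where a: "Dia a \<notin> last x" "\<And>z. z \<in> X \<Longrightarrow> z \<in> V p \<Longrightarrow> a \<in> last z"
        by (auto simp: I_def)
      have "subst_all a \<beta> \<in> last y"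
      proof (rule sp_sat[OF sp deep sat, where X = X])
        show "mcs (last y)"
          using F xy by blast
        show "v \<in> X \<and> R (last y) (last v)" if "(y, v) \<in> acc F" for v
          using that by (auto simp: acc X_def)
        show "mcs (last u)" if "u \<in> X" for u
          using that F by (auto simp: X_def)
        show "v \<in> X \<and> R (last u) (last v)" if uv: "u \<in> X" "(u, v) \<in> acc F" for u v
        proof -
          obtain r r' where "u = y @ r" "r \<noteq> []" "v = u @ r'"
            using uv by (auto simp: acc X_def)
          then have "\<exists>r. r \<noteq> [] \<and> v = y @ r"
            by (intro exI[of _ "r @ r'"]) simp
          then show ?thesis
            using uv(2) by (simp add: acc X_def)
        qed
      qed (use a in blast)
      then show False
        using gl_transitive[OF \<open>mcs (last x)\<close>] a(1) RD(3)[OF xy(3)] by blast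
    qed
    then show ?thesis
      using y(1) by blast
  qed
  moreover have "y \<in> worlds F" if "(x, y) \<in> acc F" for y
    using that acc by blast
  ultimately show "sat F V x (Imp (Dia (Var p)) (Dia (And (Var p) (Neg \<beta>))))"
    unfolding sat.simps by blast
qed

lemma finite_tree_countermodel:
  assumes "a \<notin> L"
  obtains F :: "fm set list kframe" where "kripke_frame F" "finite (worlds F)" "\<not> valid_in F a"
    and "valid_in F (Imp (Dia (Var p)) (Dia (And (Var p) (Neg \<beta>))))"
proof -
  obtain x0 where x0: "mcs x0" "a \<notin> x0"
    using refuting_mcs[OF assms] by blast
  obtain Q where Q: "finite Q" "[x0] \<in> Q" "\<And>q. q \<in> Q \<Longrightarrow> mcs (last q)"
    "\<And>q c. q \<in> Q \<Longrightarrow> c \<in> dia_args a \<Longrightarrow> Dia c \<in> last q \<Longrightarrow>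
      \<exists>y. q @ [y] \<in> Q \<and> R (last q) y \<and> c \<in> y"
    using finite_selection_tree[OF x0(1) finite_dia_args[of a]] by blast
  \<comment> \<open>Arrows lead to all proper extensions that are canonically seen, not just to
    immediate ones; the argument with a longest path relies on this.\<close>
  define F where "F = \<lparr>worlds = Q,
    acc = {(u, v). u \<in> Q \<and> v \<in> Q \<and> (\<exists>r. r \<noteq> [] \<and> v = u @ r) \<and> R (last u) (last v)}\<rparr>"
  have "sat F (\<lambda>n. {u. Var n \<in> last u}) [x0] a \<longleftrightarrow> a \<in> last [x0]"
  proof (rule truth_lemma[where \<Gamma> = "dia_args a"])
    fix u c assume "u \<in> worlds F" "c \<in> dia_args a" "Dia c \<in> last u"
    then obtain y where "u @ [y] \<in> Q" "R (last u) y" "c \<in> y"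
      using Q(4) by (auto simp: F_def)
    then show "\<exists>v\<in>worlds F. (u, v) \<in> acc F \<and> c \<in> last v"
      using \<open>u \<in> worlds F\<close> by (intro bexI[of _ "u @ [y]"]) (auto simp: F_def)
  qed (use Q in \<open>auto simp: F_def\<close>)
  then have "\<not> valid_in F a"
    using x0(2) Q(2) by (auto simp: valid_in_def F_def)
  moreover have "kripke_frame F"
    using Q(2) by (auto simp: kripke_frame_def F_def)
  moreover have "valid_in F (Imp (Dia (Var p)) (Dia (And (Var p) (Neg \<beta>))))"
    by (rule tree_valid) (use Q in \<open>auto simp: F_def\<close>)
  ultimately show ?thesis
    using that[of F] Q(1) by (simp add: F_def)
qed

end

theorem fmp_GL_Dia:
  assumes "strictly_positive p \<beta>" "0 \<notin> depths p \<beta>"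
  shows "finite_model_property (GL_Dia p \<beta>)"
  unfolding GL_Dia_def
proof (rule finite_model_propertyI)
  let ?ax = "Imp (Dia (Var p)) (Dia (And (Var p) (Neg \<beta>)))"
  interpret gl_logic "add_axiom logic_K ?ax" p \<beta>
    using assms normal_add_axiom by unfold_locales
  fix a assume "a \<notin> add_axiom logic_K ?ax"
  then obtain F :: "fm set list kframe"
    where "kripke_frame F" "finite (worlds F)" "\<not> valid_in F a" "valid_in F ?ax"
    by (rule finite_tree_countermodel)
  then show "\<exists>F :: fm set list kframe.
      kripke_frame F \<and> finite (worlds F) \<and> valid_in F ?ax \<and> \<not> valid_in F a"
    by blast
qed

theorem corollary3p5:
  fixes p :: nat and \<beta> \<gamma> :: fm
  assumes "strictly_positive p \<beta>" and "strictly_positive p \<gamma>"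
    and "p \<in> vars \<beta>" and "p \<in> vars \<gamma>"
    and "min_depth p \<beta> \<ge> 1" and "min_depth p \<gamma> \<ge> 2"
  shows "finite_model_property (K4 p \<gamma>) \<and>
         finite_model_property (wK4 p \<gamma>) \<and>
         finite_model_property (GL_Dia p \<beta>)"
proof -
  have "0 \<notin> depths p \<beta>"
  proof
    assume "0 \<in> depths p \<beta>"
    from order_trans[OF assms(5) min_depth_le[OF this]] show False
      by (simp add: one_enat_def)
  qed
  moreover have "k \<notin> depths p \<gamma>" if "k < 2" for k
  proof
    assume "k \<in> depths p \<gamma>"
    from order_trans[OF assms(6) min_depth_le[OF this]] show False
      using that by (simp add: numeral_eq_enat)
  qed
  ultimately show ?thesis
    using assms(1,2) fmp_K4 fmp_wK4 fmp_GL_Dia by simp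
qed

end
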